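(* For each $(c,\gamma)\in I$, the equation $(1-x^2)U'+2xU+\frac12U^2=P_c(x)$ has a unique solution $U^{c,\gamma}_\theta\in C^\infty(-1,1)\cap C^0[-1,1]$ satisfying $U^{c,\gamma}_\theta(0)=\gamma$. Moreover, these are all the $(-1)$-homogeneous axisymmetric no-swirl solutions of the stationary Navier–Stokes equations $-\Delta u+u\cdot\nabla u+\nabla p=0$, $\operatorname{div}u=0$ in $\mathbb{R}^3$ that are smooth on $\mathbb{S}^2\setminus\{S,N\}$ (i.e. every such solution corresponds, via $U_\theta=u_\theta\sin\theta$ and $x=\cos\theta$, to some $U^{c,\gamma}_\theta$ with $(c,\gamma)\in I$).
   Context: Use spherical coordinates $(r,\theta,\phi)$; $S,N$ are the south and north poles. A vector field $u=u_re_r+u_\theta e_\theta+u_\phi e_\phi$ is axisymmetric if $u_r,u_\theta,u_\phi$ are independent of $\phi$, and no-swirl if $u_\phi=0$. A $(-1)$-homogeneous axisymmetric no-swirl pair $(u,p)$ solves the stationary Navier–Stokes equations iff $u_\phi=0$, $u_r=-\frac{du_\theta}{d\theta}-u_\theta\cot\theta$, $p=-\frac12\big(u_r''+(\cot\theta-u_\theta)u_r'+u_r^2+u_\theta^2\big)$ (derivatives in $\theta$), and $U_\theta:=u_\theta\sin\theta$, as a function of $x=\cos\theta$, satisfies $(1-x^2)U_\theta'+2xU_\theta+\frac12U_\theta^2=P_c(x):=c_1(1-x)+c_2(1+x)+c_3(1-x^2)$ for some constants $c=(c_1,c_2,c_3)$. For $c_1,c_2\ge-1$ let $\bar c_3(c_1,c_2):=-\frac12(\sqrt{1+c_1}+\sqrt{1+c_2})(\sqrt{1+c_1}+\sqrt{1+c_2}+2)$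 and $J:=\{c: c_1\ge-1,c_2\ge-1,c_3\ge\bar c_3(c_1,c_2)\}$. For $c\in J$ the equation has solutions on $(-1,1)$ and there are solutions $U^+_\theta(c)$, $U^-_\theta(c)$ on $(-1,1)$ with $U^-_\theta(c)\le U\le U^+_\theta(c)$ for every solution $U$ on $(-1,1)$. Set $\gamma^\pm(c):=U^\pm_\theta(c)(0)$ and $I:=\{(c,\gamma)\in\mathbb{R}^4: c\in J,\ \gamma^-(c)\le\gamma\le\gamma^+(c)\}$. *)

theory Defs
  imports "HOL-Analysis.Analysis"
begin

definition Pc :: "real \<times> real \<times> real \<Rightarrow> real \<Rightarrow> real" where
  "Pc c x = (case c of (c1, c2, c3) \<Rightarrow> c1 * (1 - x) + c2 * (1 + x) + c3 * (1 - x^2))"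

definition ode_sol :: "real \<times> real \<times> real \<Rightarrow> (real \<Rightarrow> real) \<Rightarrow> bool" where
  "ode_sol c U \<longleftrightarrow> (\<forall>x\<in>{-1<..<1}. \<exists>D. (U has_real_derivative D) (at x) \<and>
      (1 - x^2) * D + 2 * x * U x + (1/2) * (U x)^2 = Pc c x)"

definition c3bar :: "real \<Rightarrow> real \<Rightarrow> real" where
  "c3bar c1 c2 = - (1/2) * (sqrt (1 + c1) + sqrt (1 + c2)) * (sqrt (1 + c1) + sqrt (1 + c2) + 2)"

definition Jset :: "(real \<times> real \<times> real) set" where
  "Jset = {(c1, c2, c3). c1 \<ge> -1 \<and> c2 \<ge> -1 \<and> c3 \<ge> c3bar c1 c2}"

definition U_plus :: "real \<times> real \<times> real \<Rightarrow> real \<Rightarrow> real" where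
  "U_plus c = (SOME U. ode_sol c U \<and> (\<forall>V. ode_sol c V \<longrightarrow> (\<forall>x\<in>{-1<..<1}. V x \<le> U x)))"

definition U_minus :: "real \<times> real \<times> real \<Rightarrow> real \<Rightarrow> real" where
  "U_minus c = (SOME U. ode_sol c U \<and> (\<forall>V. ode_sol c V \<longrightarrow> (\<forall>x\<in>{-1<..<1}. U x \<le> V x)))"

definition gamma_plus :: "real \<times> real \<times> real \<Rightarrow> real" where
  "gamma_plus c = U_plus c 0"

definition gamma_minus :: "real \<times> real \<times> real \<Rightarrow> real" where
  "gamma_minus c = U_minus c 0"

definition Iset :: "((real \<times> real \<times> real) \<times> real) set" where
  "Iset = {(c, \<gamma>). c \<in> Jset \<and> gamma_minus c \<le> \<gamma> \<and> \<gamma> \<le> gamma_plus c}"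

definition C_inf_on :: "real set \<Rightarrow> (real \<Rightarrow> real) \<Rightarrow> bool" where
  "C_inf_on S f \<longleftrightarrow> (\<forall>n. \<forall>x\<in>S. ((deriv ^^ n) f) differentiable (at x))"

text \<open>R^3 minus the x_3-axis (the cone over S^2 minus the poles S, N).\<close>
definition Omega :: "(real^3) set" where
  "Omega = {x. x $ 1 \<noteq> 0 \<or> x $ 2 \<noteq> 0}"

definition pd :: "3 \<Rightarrow> (real^3 \<Rightarrow> real) \<Rightarrow> real^3 \<Rightarrow> real" where
  "pd i f x = deriv (\<lambda>t. f (x + t *\<^sub>R axis i 1)) 0"

primrec iter_pd :: "3 list \<Rightarrow> (real^3 \<Rightarrow> real) \<Rightarrow> real^3 \<Rightarrow> real" where
  "iter_pd [] f = f"
| "iter_pd (i # is) f = pd i (iter_pd is f)"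

definition smooth3 :: "(real^3) set \<Rightarrow> (real^3 \<Rightarrow> real) \<Rightarrow> bool" where
  "smooth3 S f \<longleftrightarrow> (\<forall>is. \<forall>x\<in>S. (iter_pd is f) differentiable (at x))"

definition smooth3v :: "(real^3) set \<Rightarrow> (real^3 \<Rightarrow> real^3) \<Rightarrow> bool" where
  "smooth3v S u \<longleftrightarrow> (\<forall>j. smooth3 S (\<lambda>y. u y $ j))"

definition lap :: "(real^3 \<Rightarrow> real) \<Rightarrow> real^3 \<Rightarrow> real" where
  "lap f x = (\<Sum>i\<in>UNIV. pd i (pd i f) x)"

definition NS_solution_on :: "(real^3) set \<Rightarrow> (real^3 \<Rightarrow> real^3) \<Rightarrow> (real^3 \<Rightarrow> real) \<Rightarrow> bool" where
  "NS_solution_on S u p \<longleftrightarrow> (\<forall>x\<in>S.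
     (\<forall>j. - lap (\<lambda>y. u y $ j) x + (\<Sum>i\<in>UNIV. u x $ i * pd i (\<lambda>y. u y $ j) x) + pd j p x = 0)
     \<and> (\<Sum>i\<in>UNIV. pd i (\<lambda>y. u y $ i) x) = 0)"

definition homog_pair :: "(real^3 \<Rightarrow> real^3) \<Rightarrow> (real^3 \<Rightarrow> real) \<Rightarrow> bool" where
  "homog_pair u p \<longleftrightarrow> (\<forall>x\<in>Omega. \<forall>s>0. u (s *\<^sub>R x) = (1 / s) *\<^sub>R u x \<and> p (s *\<^sub>R x) = p x / s^2)"

definition sph :: "real \<Rightarrow> real \<Rightarrow> real \<Rightarrow> real^3" where
  "sph r \<theta> \<phi> = vector [r * sin \<theta> * cos \<phi>, r * sin \<theta> * sin \<phi>, r * cos \<theta>]"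

definition e_r :: "real \<Rightarrow> real \<Rightarrow> real^3" where
  "e_r \<theta> \<phi> = vector [sin \<theta> * cos \<phi>, sin \<theta> * sin \<phi>, cos \<theta>]"

definition e_th :: "real \<Rightarrow> real \<Rightarrow> real^3" where
  "e_th \<theta> \<phi> = vector [cos \<theta> * cos \<phi>, cos \<theta> * sin \<phi>, - sin \<theta>]"

definition e_ph :: "real \<Rightarrow> real \<Rightarrow> real^3" where
  "e_ph \<theta> \<phi> = vector [- sin \<phi>, cos \<phi>, 0]"

definition u_r :: "(real^3 \<Rightarrow> real^3) \<Rightarrow> real \<Rightarrow> real \<Rightarrow> real \<Rightarrow> real" where
  "u_r u r \<theta> \<phi> = u (sph r \<theta> \<phi>) \<bullet> e_r \<theta> \<phi>"

definition u_th :: "(real^3 \<Rightarrow> real^3) \<Rightarrow> real \<Rightarrow> real \<Rightarrow> real \<Rightarrow> real" where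
  "u_th u r \<theta> \<phi> = u (sph r \<theta> \<phi>) \<bullet> e_th \<theta> \<phi>"

definition u_ph :: "(real^3 \<Rightarrow> real^3) \<Rightarrow> real \<Rightarrow> real \<Rightarrow> real \<Rightarrow> real" where
  "u_ph u r \<theta> \<phi> = u (sph r \<theta> \<phi>) \<bullet> e_ph \<theta> \<phi>"

definition axisymmetric :: "(real^3 \<Rightarrow> real^3) \<Rightarrow> bool" where
  "axisymmetric u \<longleftrightarrow> (\<forall>r>0. \<forall>\<theta>\<in>{0<..<pi}. \<forall>\<phi> \<phi>'.
      u_r u r \<theta> \<phi> = u_r u r \<theta> \<phi>' \<and> u_th u r \<theta> \<phi> = u_th u r \<theta> \<phi>' \<and> u_ph u r \<theta> \<phi> = u_ph u r \<theta> \<phi>')"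

definition no_swirl :: "(real^3 \<Rightarrow> real^3) \<Rightarrow> bool" where
  "no_swirl u \<longleftrightarrow> (\<forall>r>0. \<forall>\<theta>\<in>{0<..<pi}. \<forall>\<phi>. u_ph u r \<theta> \<phi> = 0)"

end

theory Submission
  imports Defs
begin

text \<open>With \<open>x = tanh t\<close> and \<open>v = U + 2 x\<close> the equation becomes the Riccati equation
  \<open>v' = Q t - v\<^sup>2 / 2\<close> on the whole line, \<open>Q t = Pc c (tanh t) + 2\<close>. All its global solutions are
  obtained from one of them by a parameter running through a closed interval, which gives \<open>U_plus\<close>,
  \<open>U_minus\<close> and one solution for each value at \<open>0\<close> in between. Since \<open>Q\<close> has limits at both ends, a
  global solution converges there (and the limits of \<open>Q\<close> are nonnegative, i.e. \<open>c1, c2 \<ge> -1\<close>).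
  Comparison with the explicit solution for \<open>c3 = c3bar c1 c2\<close> yields \<open>c3 \<ge> c3bar c1 c2\<close>; conversely,
  a hypergeometric series with nonnegative coefficients gives a solution for each \<open>c \<in> Jset\<close>.
  For the Navier-Stokes part, homogeneity and axial symmetry express all derivatives at \<open>(1, 0, s)\<close>
  through functions of \<open>s = cot \<theta>\<close>, and the resulting third order equation is integrated three times;
  the constants of integration are \<open>c\<close>.\<close>

section \<open>Riccati equations on the line\<close>

text \<open>The shift by 2 x completes the square: \<open>2 * x * U + U^2 / 2\<close> is
  \<open>(U + 2 * x)^2 / 2 - 2 * x^2\<close>, and as tanh' = 1 - x^2, what is left over is the
  constant 2. The obstacle is that 1 - x^2 vanishes at both endpoints, so the equation says nothing
  directly about limits there. In the variable t this becomes a question about t tending to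
  infinity. If c1 = -1 or c2 = -1, the limit q of \<open>Q\<close> at that end is 0 and the two
  equilibria of v' = q - v^2 / 2 merge, so linearisation fails. The arguments therefore rest on
  signs and on blow-up in finite time, which treat the borderline like all other cases.
  \<open>U_plus\<close> and \<open>U_minus\<close> are picked by choice and carry no information
  until some solution is known to exist; hence the separate construction on \<open>Jset\<close>. The
  pressure is assumed homogeneous but not axisymmetric, so the Navier-Stokes equations are read on
  one half-plane bounded by the axis, in the two components tangent to it.\<close>

definition riccati :: "(real \<Rightarrow> real) \<Rightarrow> (real \<Rightarrow> real) \<Rightarrow> bool" where
  "riccati Q v \<longleftrightarrow> (\<forall>t. (v has_real_derivative Q t - (v t)\<^sup>2 / 2) (at t))"

lemma riccatiD: "riccati Q v \<Longrightarrow> (v has_real_derivative Q t - (v t)\<^sup>2 / 2) (at t)"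
  unfolding riccati_def by blast

lemma riccati_reflect:
  assumes "riccati Q v"
  shows "riccati (\<lambda>t. Q (- t)) (\<lambda>t. - v (- t))"
  unfolding riccati_def
proof
  fix t
  have "((\<lambda>t. v (- t)) has_real_derivative (Q (- t) - (v (- t))\<^sup>2 / 2) * (-1)) (at t)"
    by (rule DERIV_chain2[OF riccatiD[OF assms]]) (auto intro!: derivative_eq_intros)
  from DERIV_minus[OF this]
  show "((\<lambda>t. - v (- t)) has_real_derivative Q (- t) - (- v (- t))\<^sup>2 / 2) (at t)" by simp
qed

lemma riccati_isCont: "riccati Q v \<Longrightarrow> isCont v t"
  using riccatiD DERIV_isCont by blast

lemma antiderivative_on_line:
  fixes f :: "real \<Rightarrow> real"
  assumes "\<And>t. isCont f t"
  obtains F where "F 0 = 0" "\<And>t. (F has_real_derivative f t) (at t)"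
proof -
  have "\<exists>F. \<forall>x::real. -\<infinity> < ereal x \<longrightarrow> ereal x < \<infinity> \<longrightarrow> (F has_vector_derivative f x) (at x)"
    by (rule einterval_antiderivative) (use assms in auto)
  then obtain F where F: "\<And>x. (F has_real_derivative f x) (at x)"
    by (auto simp: has_real_derivative_iff_has_vector_derivative)
  have "((\<lambda>t. F t - F 0) has_real_derivative f t) (at t)" for t
    by (auto intro!: derivative_eq_intros F)
  then show ?thesis using that[of "\<lambda>t. F t - F 0"] by auto
qed

text \<open>Two solutions differ by \<open>d\<close> with \<open>d' = - v d - d\<^sup>2 / 2\<close>. In terms of the Wronskian of the
  associated linear equation, \<open>m = exp (1/2 \<integral> d)\<close> is the quotient of two linear solutions and
  \<open>E = 1 / w\<^sup>2\<close> for the solution \<open>w\<close> belonging to \<open>v\<close>; this makes \<open>m\<close> affine in \<open>F = \<integral> E\<close>.\<close>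

lemma riccati_family:
  assumes v: "riccati Q v"
  obtains E F where "\<And>t. E t > 0" "E 0 = 1" "F 0 = 0" "strict_mono F"
    "\<And>s. \<forall>t. 1 + s * F t > 0 \<Longrightarrow> riccati Q (\<lambda>t. v t + 2 * s * E t / (1 + s * F t))"
    "\<And>v'. riccati Q v' \<Longrightarrow> \<exists>s. \<forall>t. 1 + s * F t > 0 \<and> v' t = v t + 2 * s * E t / (1 + s * F t)"
proof -
  obtain V where V: "V 0 = 0" "\<And>t. (V has_real_derivative v t) (at t)"
    using antiderivative_on_line[of v] riccati_isCont[OF v] by blast
  define E where "E t = exp (- V t)" for t
  have E': "(E has_real_derivative - v t * E t) (at t)" for t
    unfolding E_def by (auto intro!: derivative_eq_intros V)
  have Epos: "E t > 0" for t by (simp add: E_def)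
  obtain F where F: "F 0 = 0" "\<And>t. (F has_real_derivative E t) (at t)"
    using antiderivative_on_line[of E] E' DERIV_isCont by blast
  have "strict_mono F"
    by (rule strict_monoI, rule DERIV_pos_imp_increasing) (use F Epos in blast)+
  moreover have "riccati Q (\<lambda>t. v t + 2 * s * E t / (1 + s * F t))"
    if pos: "\<forall>t. 1 + s * F t > 0" for s
    unfolding riccati_def
  proof
    fix t
    define m where "m = 1 + s * F t"
    have m: "m \<noteq> 0" using spec[OF pos, of t] by (simp add: m_def)
    have "((\<lambda>t. v t + 2 * s * E t / (1 + s * F t)) has_real_derivative
        Q t - (v t)\<^sup>2 / 2 + (2 * s * (- v t * E t) * m - 2 * s * E t * (s * E t)) / (m * m)) (at t)"
      by (rule derivative_eq_intros riccatiD[OF v] E' F refl | use m in \<open>simp add: m_def\<close>)+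
    moreover have "Q t - (v t)\<^sup>2 / 2 + (2 * s * (- v t * E t) * m - 2 * s * E t * (s * E t)) / (m * m)
        = Q t - (v t + 2 * s * E t / m)\<^sup>2 / 2"
      using m by (simp add: field_simps power2_eq_square)
    ultimately show "((\<lambda>t. v t + 2 * s * E t / (1 + s * F t)) has_real_derivative
        Q t - (v t + 2 * s * E t / (1 + s * F t))\<^sup>2 / 2) (at t)"
      by (simp only: m_def)
  qed
  moreover have "\<exists>s. \<forall>t. 1 + s * F t > 0 \<and> v' t = v t + 2 * s * E t / (1 + s * F t)"
    if v': "riccati Q v'" for v'
  proof -
    define d where "d t = v' t - v t" for t
    have d': "(d has_real_derivative - v t * d t - (d t)\<^sup>2 / 2) (at t)" for t
      unfolding d_def
      by (auto intro!: derivative_eq_intros riccatiD[OF v] riccatiD[OF v'] simp: field_simps power2_eq_square)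
    obtain D where D: "D 0 = 0" "\<And>t. (D has_real_derivative d t) (at t)"
      using antiderivative_on_line[of d] d' DERIV_isCont by blast
    define m where "m t = exp (D t / 2)" for t
    have m': "(m has_real_derivative d t * m t / 2) (at t)" for t
      unfolding m_def by (auto intro!: derivative_eq_intros D)
    define s where "s = d 0 / 2"
    \<comment> \<open>With \<open>E = 1 / w^2\<close> this is twice the Wronskian
      \<open>w^2 * m'\<close> of the linear solutions w and w m, hence constant. Its value at 0 is
      \<open>d 0 = 2 * s\<close>, so that \<open>m' = s * E\<close>.\<close>
    have "((\<lambda>t. d t * m t / E t) has_real_derivative 0) (at t)" for t
      using Epos[of t]
      by (auto intro!: derivative_eq_intros d' m' E' simp: field_simps power2_eq_square)
    then have "d t * m t / E t = d 0 * m 0 / E 0" for t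
      using DERIV_isconst_all[of "\<lambda>t. d t * m t / E t"] by blast
    then have dm: "d t * m t = 2 * s * E t" for t
      using Epos[of t] by (simp add: s_def m_def D(1) E_def V(1) field_simps)
    have "((\<lambda>t. m t - s * F t) has_real_derivative 0) (at t)" for t
      by (rule derivative_eq_intros m' F refl)+ (use dm[of t] in simp)
    then have "m t - s * F t = m 0 - s * F 0" for t
      using DERIV_isconst_all[of "\<lambda>t. m t - s * F t"] by blast
    then have m: "m t = 1 + s * F t" for t
      by (simp add: m_def D(1) F(1) algebra_simps)
    have "1 + s * F t > 0 \<and> v' t = v t + 2 * s * E t / (1 + s * F t)" for t
    proof -
      have p: "m t > 0" by (simp add: m_def)
      then have "d t = 2 * s * E t / m t" using dm[of t] by (simp add: field_simps)
      with p m[of t] show ?thesis by (simp add: d_def)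
    qed
    then show ?thesis by blast
  qed
  ultimately show ?thesis
    using that[of E F] Epos F(1) by (simp add: E_def V(1))
qed

text \<open>The member of the family with parameter s takes the value \<open>v 0 + 2 * s\<close> at
  0, so the value at 0 determines s.\<close>

lemma riccati_unique:
  assumes "riccati Q v" "riccati Q v'" "v' 0 = v 0"
  shows "v' = v"
proof -
  obtain E F where E: "\<And>t. E t > 0" "E 0 = 1" "F 0 = 0" "strict_mono F" and
    fam: "\<And>s. \<forall>t. 1 + s * F t > 0 \<Longrightarrow> riccati Q (\<lambda>t. v t + 2 * s * E t / (1 + s * F t))" and
    all: "\<And>v'. riccati Q v' \<Longrightarrow> \<exists>s. \<forall>t. 1 + s * F t > 0 \<and> v' t = v t + 2 * s * E t / (1 + s * F t)"
    by (rule riccati_family[OF assms(1)]) (rule that; assumption)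
  obtain s where s: "\<forall>t. 1 + s * F t > 0 \<and> v' t = v t + 2 * s * E t / (1 + s * F t)"
    using all[OF assms(2)] by blast
  then have "v' 0 = v 0 + 2 * s * E 0 / (1 + s * F 0)" by blast
  then have "s = 0" using assms(3) E by simp
  with s show ?thesis by auto
qed

text \<open>The admissible parameters form an interval containing 0, because the condition
  \<open>1 + s * F t > 0\<close> is affine in s for each t.\<close>

lemma riccati_between:
  assumes v: "riccati Q v" and v': "riccati Q v'" and g: "v 0 \<le> g" "g \<le> v' 0"
  shows "\<exists>w. riccati Q w \<and> w 0 = g"
proof -
  obtain E F where E: "\<And>t. E t > 0" "E 0 = 1" "F 0 = 0" "strict_mono F" and
    fam: "\<And>s. \<forall>t. 1 + s * F t > 0 \<Longrightarrow> riccati Q (\<lambda>t. v t + 2 * s * E t / (1 + s * F t))" and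
    all: "\<And>v'. riccati Q v' \<Longrightarrow> \<exists>s. \<forall>t. 1 + s * F t > 0 \<and> v' t = v t + 2 * s * E t / (1 + s * F t)"
    by (rule riccati_family[OF v]) (rule that; assumption)
  obtain s where s: "\<And>t. 1 + s * F t > 0" "\<And>t. v' t = v t + 2 * s * E t / (1 + s * F t)"
    using all[OF v'] by blast
  define r where "r = (g - v 0) / 2"
  have r: "0 \<le> r" "r \<le> s" using g s(2)[of 0] E by (auto simp: r_def)
  have "1 + r * F t > 0" for t
  proof (cases "F t \<ge> 0")
    case True
    then show ?thesis using r by (smt (verit) mult_nonneg_nonneg)
  next
    case False
    then have "s * F t \<le> r * F t" using r by (simp add: mult_right_mono_neg)
    then show ?thesis using s(1)[of t] by linarith
  qed
  then have pos: "\<forall>t. 1 + r * F t > 0" by blast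
  from fam[OF this] show ?thesis
    by (rule_tac x="\<lambda>t. v t + 2 * r * E t / (1 + r * F t)" in exI) (simp add: E r_def field_simps)
qed

text \<open>The solution increases with s, since \<open>s / (1 + s * F)\<close> does, so the largest
  admissible parameter is wanted. For s \<ge> 0 only times t < 0, where F is negative, restrict s.
  The supremum inherits the constraints in weak form at first and has to be shown
  admissible.\<close>

lemma riccati_max:
  assumes v: "riccati Q v"
  shows "\<exists>w. riccati Q w \<and> (\<forall>v'. riccati Q v' \<longrightarrow> (\<forall>t. v' t \<le> w t))"
proof -
  obtain E F where E: "\<And>t. E t > 0" "E 0 = 1" "F 0 = 0" "strict_mono F" and
    fam: "\<And>s. \<forall>t. 1 + s * F t > 0 \<Longrightarrow> riccati Q (\<lambda>t. v t + 2 * s * E t / (1 + s * F t))" and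
    all: "\<And>v'. riccati Q v' \<Longrightarrow> \<exists>s. \<forall>t. 1 + s * F t > 0 \<and> v' t = v t + 2 * s * E t / (1 + s * F t)"
    by (rule riccati_family[OF v]) (rule that; assumption)
  define S where "S = {s. \<forall>t. 1 + s * F t > 0}"
  have neg: "F t < 0" if "t < 0" for t
    using E(3) strict_monoD[OF E(4) that] by simp
  have "bdd_above S"
  proof (rule bdd_aboveI)
    fix s assume "s \<in> S"
    then have "1 + s * F (-1) > 0" by (simp add: S_def)
    then show "s \<le> - 1 / F (-1)" using neg[of "-1"] by (simp add: field_simps)
  qed
  moreover have zero: "0 \<in> S" by (simp add: S_def)
  ultimately have ub: "\<And>s. s \<in> S \<Longrightarrow> s \<le> Sup S"
    and sup: "\<And>z. (\<And>s. s \<in> S \<Longrightarrow> s \<le> z) \<Longrightarrow> Sup S \<le> z"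
    using cSup_upper[of _ S] cSup_least[of S] by auto
  define r where "r = Sup S"
  have r0: "r \<ge> 0" using ub[OF zero] by (simp add: r_def)
  have weak: "1 + r * F t \<ge> 0" if "t < 0" for t
  proof -
    have "r \<le> - 1 / F t" unfolding r_def
    proof (rule sup)
      fix s assume "s \<in> S"
      then have "1 + s * F t > 0" by (simp add: S_def)
      then show "s \<le> - 1 / F t" using neg[OF that] by (simp add: field_simps)
    qed
    then show ?thesis using neg[OF that] by (simp add: field_simps)
  qed
  have pos: "1 + r * F t > 0" for t
  proof (cases "t < 0")
    case True
    \<comment> \<open>The weak inequality at the earlier time t - 1 yields the strict one at t
      because F is strictly increasing.\<close>
    have "F (t - 1) < F t" using strict_monoD[OF E(4), of "t - 1" t] by simp
    then have "r = 0 \<or> r * F (t - 1) < r * F t" using r0 by (metis le_less mult_strict_left_mono)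
    then show ?thesis using weak[of "t - 1"] True by auto
  next
    case False
    then have "F t \<ge> 0" using strict_mono_mono[OF E(4)] E(3) by (metis monoD not_less)
    then show ?thesis using r0 by (smt (verit) mult_nonneg_nonneg)
  qed
  have "v' t \<le> v t + 2 * r * E t / (1 + r * F t)" if v': "riccati Q v'" for v' t
  proof -
    obtain s where s: "\<And>t. 1 + s * F t > 0" "\<And>t. v' t = v t + 2 * s * E t / (1 + s * F t)"
      using all[OF v'] by blast
    have "s \<le> r" using s(1) ub by (simp add: S_def r_def)
    then have "s * (1 + r * F t) \<le> r * (1 + s * F t)" by (simp add: algebra_simps)
    then have "s / (1 + s * F t) \<le> r / (1 + r * F t)"
      using s(1)[of t] pos[of t] by (simp add: frac_le_eq divide_le_eq field_simps)
    then have "2 * E t * (s / (1 + s * F t)) \<le> 2 * E t * (r / (1 + r * F t))"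
      using E(1)[of t] by (intro mult_left_mono) auto
    then show ?thesis by (simp add: s(2) mult_ac)
  qed
  then show ?thesis using fam[of r] pos by blast
qed

lemma riccati_min:
  assumes v: "riccati Q v"
  shows "\<exists>w. riccati Q w \<and> (\<forall>v'. riccati Q v' \<longrightarrow> (\<forall>t. w t \<le> v' t))"
proof -
  obtain w where w: "riccati (\<lambda>t. Q (- t)) w"
    and max: "\<And>v' t. riccati (\<lambda>t. Q (- t)) v' \<Longrightarrow> v' t \<le> w t"
    using riccati_max[OF riccati_reflect[OF v]] by blast
  have "- w (- t) \<le> v' t" if "riccati Q v'" for v' t
    using max[OF riccati_reflect[OF that], of "- t"] by simp
  then show ?thesis using riccati_reflect[OF w] by (intro exI[of _ "\<lambda>t. - w (- t)"]) auto
qed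

section \<open>Behaviour of Riccati solutions at infinity\<close>

text \<open>A negative value would blow up in finite time: once G < 0 it stays so, and then
  \<open>1 / G t - k * t\<close> is nondecreasing, which drives the negative quantity 1 / G up to
  0.\<close>

lemma quadratic_decay_nonneg:
  fixes G G' :: "real \<Rightarrow> real"
  assumes "k > 0" and der: "\<And>t. t \<ge> T \<Longrightarrow> (G has_real_derivative G' t) (at t)"
    and le: "\<And>t. t \<ge> T \<Longrightarrow> G' t \<le> - k * (G t)\<^sup>2" and "t \<ge> T"
  shows "G t \<ge> 0"
proof (rule ccontr)
  assume "\<not> G t \<ge> 0"
  then have neg: "G t < 0" by simp
  have neg': "G u < 0" if "u \<ge> t" for u
  proof -
    have "G u \<le> G t"
    proof (rule DERIV_nonpos_imp_nonincreasing[OF that])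
      fix x assume "t \<le> x"
      then have "G' x \<le> 0" using le[of x] \<open>t \<ge> T\<close> \<open>k > 0\<close>
        by (smt (verit) mult_minus_left mult_nonneg_nonneg zero_le_power2)
      then show "\<exists>y. DERIV G x :> y \<and> y \<le> 0" using der[of x] \<open>t \<le> x\<close> \<open>t \<ge> T\<close> by auto
    qed
    then show ?thesis using neg by linarith
  qed
  \<comment> \<open>The time at which the lower bound \<open>1 / G t + k * (u - t)\<close> for
    \<open>1 / G u\<close> reaches 0.\<close>
  define u where "u = t - 1 / (k * G t)"
  have "u > t" using neg \<open>k > 0\<close> by (simp add: u_def divide_neg_pos mult_pos_neg divide_pos_neg)
  have "1 / G t - k * t \<le> 1 / G u - k * u"
  proof (rule DERIV_nonneg_imp_nondecreasing[of t u "\<lambda>x. 1 / G x - k * x"])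
    fix x assume "t \<le> x"
    then have x: "x \<ge> T" "G x < 0" using \<open>t \<ge> T\<close> neg' by auto
    have "((\<lambda>x. 1 / G x - k * x) has_real_derivative - G' x / (G x)\<^sup>2 - k) (at x)"
      by (rule derivative_eq_intros der refl x)+ (use x in \<open>auto simp: power2_eq_square\<close>)
    moreover have "- G' x / (G x)\<^sup>2 - k \<ge> 0"
      using le[OF x(1)] x(2) by (simp add: field_simps)
    ultimately show "\<exists>y. ((\<lambda>x. 1 / G x - k * x) has_real_derivative y) (at x) \<and> y \<ge> 0" by blast
  qed (use \<open>u > t\<close> in simp)
  moreover have "k * u = k * t - 1 / G t" using neg \<open>k > 0\<close> by (simp add: u_def field_simps)
  ultimately have "0 \<le> 1 / G u" by simp
  then show False using neg'[of u] \<open>u > t\<close> by simp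
qed

text \<open>The inequality is invariant under replacing G by \<open>\<lambda>t. - G (- t)\<close>,
  so blow-up in backward time excludes positive values just as forward blow-up excludes negative
  ones.\<close>

lemma quadratic_decay_on_line:
  fixes G G' :: "real \<Rightarrow> real"
  assumes "k > 0" and der: "\<And>t. (G has_real_derivative G' t) (at t)"
    and le: "\<And>t. G' t \<le> - k * (G t)\<^sup>2"
  shows "G t = 0"
proof -
  have "G t \<ge> 0" by (rule quadratic_decay_nonneg[of k t G G']) (use assms in auto)
  moreover have "- G (- (- t)) \<ge> 0"
  proof (rule quadratic_decay_nonneg[of k "- t" "\<lambda>t. - G (- t)" "\<lambda>t. G' (- t)"])
    show "((\<lambda>t. - G (- t)) has_real_derivative G' (- x)) (at x)" for x
      using DERIV_minus[OF DERIV_chain2[OF der[of "- x"] DERIV_minus[OF DERIV_ident]]] by simp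
  qed (use assms in auto)
  ultimately show ?thesis by simp
qed

lemma negative_drift_unbounded:
  fixes v v' :: "real \<Rightarrow> real"
  assumes "\<eta> > 0" and "\<forall>\<^sub>F t in at_top. (v has_real_derivative v' t) (at t) \<and> v' t \<le> - \<eta>"
    and "\<forall>\<^sub>F t in at_top. v t \<ge> b"
  shows False
proof -
  obtain T where T: "\<And>t. t \<ge> T \<Longrightarrow> (v has_real_derivative v' t) (at t) \<and> v' t \<le> - \<eta> \<and> v t \<ge> b"
    using eventually_conj[OF assms(2,3)] by (auto simp: eventually_at_top_linorder)
  define u where "u = T + (v T - b + 1) / \<eta>"
  have "u \<ge> T" using T[of T] \<open>\<eta> > 0\<close> by (simp add: u_def)
  have "v u + \<eta> * u \<le> v T + \<eta> * T"
  proof (rule DERIV_nonpos_imp_nonincreasing[OF \<open>u \<ge> T\<close>, of "\<lambda>t. v t + \<eta> * t"])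
    fix x assume "T \<le> x"
    then have "((\<lambda>t. v t + \<eta> * t) has_real_derivative v' x + \<eta>) (at x)"
      using T by (auto intro!: derivative_eq_intros)
    then show "\<exists>y. ((\<lambda>t. v t + \<eta> * t) has_real_derivative y) (at x) \<and> y \<le> 0"
      using T[OF \<open>T \<le> x\<close>] by (smt (verit))
  qed
  moreover have "\<eta> * u = \<eta> * T + v T - b + 1" using \<open>\<eta> > 0\<close> by (simp add: u_def field_simps)
  ultimately show False using T[OF \<open>u \<ge> T\<close>] by linarith
qed

text \<open>The integrating factor \<open>exp (1/2 \<integral> (v + b))\<close> turns \<open>v - b\<close> into a function which is
  eventually strictly monotone, so that it changes sign at most once.\<close>

lemma riccati_sign_eventually:
  assumes v: "riccati Q v" and Q: "(Q \<longlongrightarrow> q) at_top" and b: "b\<^sup>2 \<noteq> 2 * q"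
  shows "(\<forall>\<^sub>F t in at_top. v t > b) \<or> (\<forall>\<^sub>F t in at_top. v t < b)"
proof -
  obtain V where V: "\<And>t. (V has_real_derivative v t + b) (at t)"
    using antiderivative_on_line[of "\<lambda>t. v t + b"] continuous_add[OF riccati_isCont[OF v] continuous_const]
    by metis
  \<comment> \<open>In H' the factor \<open>(v + b) * (v - b) / 2\<close> cancels the quadratic term
    of the Riccati equation and leaves a positive multiple of \<open>Q t - b^2 / 2\<close>. Its sign
    is eventually fixed because its limit is not 0.\<close>
  define H where "H t = exp (V t / 2) * (v t - b)" for t
  have H': "(H has_real_derivative exp (V t / 2) * (Q t - b\<^sup>2 / 2)) (at t)" for t
    unfolding H_def
    by (auto intro!: derivative_eq_intros V riccatiD[OF v] simp: field_simps power2_eq_square)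
  have sgn: "H t > 0 \<longleftrightarrow> v t > b" "H t < 0 \<longleftrightarrow> v t < b" for t
    by (auto simp: H_def zero_less_mult_iff mult_less_0_iff)
  consider "b\<^sup>2 / 2 < q" | "b\<^sup>2 / 2 > q" using b by linarith
  then show ?thesis
  proof cases
    case 1
    then obtain T where T: "\<And>t. t \<ge> T \<Longrightarrow> Q t > b\<^sup>2 / 2"
      using order_tendstoD(1)[OF Q 1] by (auto simp: eventually_at_top_linorder)
    show ?thesis
    proof (cases "\<exists>t0\<ge>T. H t0 \<ge> 0")
      case True
      then obtain t0 where t0: "t0 \<ge> T" "H t0 \<ge> 0" by blast
      have "v t > b" if "t > t0" for t
      proof -
        have "H t0 < H t"
        proof (rule DERIV_pos_imp_increasing[OF that])
          fix x assume "t0 \<le> x"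
          then have "exp (V x / 2) * (Q x - b\<^sup>2 / 2) > 0" using T[of x] t0 by simp
          then show "\<exists>y. DERIV H x :> y \<and> y > 0" using H' by blast
        qed
        with t0 have "H t > 0" by linarith
        then show ?thesis by (simp add: sgn)
      qed
      then show ?thesis unfolding eventually_at_top_dense by blast
    next
      case False
      then have "\<forall>t\<ge>T. v t < b" using sgn by (metis not_le)
      then show ?thesis unfolding eventually_at_top_linorder by blast
    qed
  next
    case 2
    then obtain T where T: "\<And>t. t \<ge> T \<Longrightarrow> Q t < b\<^sup>2 / 2"
      using order_tendstoD(2)[OF Q 2] by (auto simp: eventually_at_top_linorder)
    show ?thesis
    proof (cases "\<exists>t0\<ge>T. H t0 \<le> 0")
      case True
      then obtain t0 where t0: "t0 \<ge> T" "H t0 \<le> 0" by blast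
      have "v t < b" if "t > t0" for t
      proof -
        have "H t0 > H t"
        proof (rule DERIV_neg_imp_decreasing[OF that])
          fix x assume "t0 \<le> x"
          then have "exp (V x / 2) * (Q x - b\<^sup>2 / 2) < 0" using T[of x] t0 by (simp add: mult_less_0_iff)
          then show "\<exists>y. DERIV H x :> y \<and> y < 0" using H' by blast
        qed
        with t0 have "H t < 0" by linarith
        then show ?thesis by (simp add: sgn)
      qed
      then show ?thesis unfolding eventually_at_top_dense by blast
    next
      case False
      then have "\<forall>t\<ge>T. v t > b" using sgn by (metis not_le)
      then show ?thesis unfolding eventually_at_top_linorder by blast
    qed
  qed
qed

text \<open>If q < 0, then eventually v' is at most both - v^2 / 2 and q / 2. The first bound forces
  v \<ge> 0, the second drives v to minus infinity. For the reduced equation this becomes c2 \<ge>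
  -1 and, by reflection, c1 \<ge> -1.\<close>

lemma riccati_limit_nonneg:
  assumes v: "riccati Q v" and Q: "(Q \<longlongrightarrow> q) at_top"
  shows "q \<ge> 0"
proof (rule ccontr)
  assume "\<not> q \<ge> 0"
  then have "q < q / 2" by simp
  then obtain T where T: "\<And>t. t \<ge> T \<Longrightarrow> Q t < q / 2"
    using order_tendstoD(2)[OF Q, of "q / 2"] by (auto simp: eventually_at_top_linorder)
  have "v t \<ge> 0" if "t \<ge> T" for t
  proof (rule quadratic_decay_nonneg[of "1/2" T v "\<lambda>t. Q t - (v t)\<^sup>2 / 2"])
    show "Q t - (v t)\<^sup>2 / 2 \<le> - (1 / 2) * (v t)\<^sup>2" if "t \<ge> T" for t
      using T[OF that] \<open>\<not> q \<ge> 0\<close> by simp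
  qed (use riccatiD[OF v] that in auto)
  then have "\<forall>\<^sub>F t in at_top. v t \<ge> 0" unfolding eventually_at_top_linorder by blast
  moreover have "\<forall>\<^sub>F t in at_top. (v has_real_derivative Q t - (v t)\<^sup>2 / 2) (at t)
      \<and> Q t - (v t)\<^sup>2 / 2 \<le> - (- q / 2)"
    using eventually_ge_at_top[of T]
  proof eventually_elim
    case (elim t)
    have "0 \<le> (v t)\<^sup>2" by simp
    with T[OF elim] have "Q t - (v t)\<^sup>2 / 2 \<le> - (- q / 2)" by linarith
    then show ?case using riccatiD[OF v, of t] by blast
  qed
  ultimately show False using negative_drift_unbounded[of "- q / 2" v "\<lambda>t. Q t - (v t)\<^sup>2 / 2" 0] \<open>\<not> q \<ge> 0\<close>
    by auto
qed

text \<open>The limit arises as a cut: every level a with \<open>a^2 \<noteq> 2 * q\<close> is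
  eventually below or eventually above v, and l is the supremum of the levels eventually below.
  Drift bounds these levels from above, and blow-up shows that there are some.\<close>

lemma riccati_converges:
  assumes v: "riccati Q v" and Q: "(Q \<longlongrightarrow> q) at_top"
  shows "\<exists>l. (v \<longlongrightarrow> l) at_top"
proof -
  have q: "q \<ge> 0" using riccati_limit_nonneg[OF assms] .
  \<comment> \<open>Chosen so that \<open>b^2 / 4 = q + 1\<close> exceeds Q eventually. Beyond b in
    absolute value, v' is then at most - v^2 / 4, and above b also at most -1.\<close>
  define b where "b = 2 * sqrt (q + 1)"
  have b: "b > 0" "b\<^sup>2 = 4 * (q + 1)" using q by (auto simp: b_def power_mult_distrib)
  obtain T where T: "\<And>t. t \<ge> T \<Longrightarrow> Q t < q + 1"
    using order_tendstoD(2)[OF Q, of "q + 1"] by (auto simp: eventually_at_top_linorder)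
  define S where "S = {a. \<forall>\<^sub>F t in at_top. v t > a}"
  have down: "a' \<in> S" if "a \<in> S" "a' \<le> a" for a a'
    using that by (auto simp: S_def elim: eventually_mono)
  have dich: "a \<in> S \<or> (\<forall>\<^sub>F t in at_top. v t < a)" if "a\<^sup>2 \<noteq> 2 * q" for a
    using riccati_sign_eventually[OF v Q that] by (auto simp: S_def)
  have "b \<notin> S"
  proof
    assume "b \<in> S"
    then have ev: "\<forall>\<^sub>F t in at_top. v t > b" by (simp add: S_def)
    have "\<forall>\<^sub>F t in at_top. (v has_real_derivative Q t - (v t)\<^sup>2 / 2) (at t) \<and> Q t - (v t)\<^sup>2 / 2 \<le> - 1"
      using ev eventually_ge_at_top[of T]
    proof eventually_elim
      case (elim t)
      have "b\<^sup>2 \<le> (v t)\<^sup>2" using elim b by (intro power_mono) auto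
      then show ?case using T[OF elim(2)] b q riccatiD[OF v, of t] by auto
    qed
    moreover have "\<forall>\<^sub>F t in at_top. v t \<ge> b" using ev by (rule eventually_mono) simp
    ultimately show False using negative_drift_unbounded[of 1 v _ b] by simp
  qed
  then have bdd: "bdd_above S" using down by (meson bdd_aboveI linear)
  have "- b \<in> S"
  proof (rule ccontr)
    assume "- b \<notin> S"
    then have "\<forall>\<^sub>F t in at_top. v t < - b" using dich[of "- b"] b q by auto
    then obtain T' where T': "\<And>t. t \<ge> T' \<Longrightarrow> v t < - b" by (auto simp: eventually_at_top_linorder)
    have "v (max T T') \<ge> 0"
    proof (rule quadratic_decay_nonneg[of "1/4" "max T T'" v "\<lambda>t. Q t - (v t)\<^sup>2 / 2"])
      fix t assume t: "max T T' \<le> t"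
      have "b\<^sup>2 \<le> (- v t)\<^sup>2" using T'[of t] t b by (intro power_mono) auto
      then show "Q t - (v t)\<^sup>2 / 2 \<le> - (1 / 4) * (v t)\<^sup>2" using T[of t] t b by auto
    qed (use riccatiD[OF v] in auto)
    then show False using T'[of "max T T'"] b by simp
  qed
  then have ne: "S \<noteq> {}" by blast
  define l where "l = Sup S"
  have "(v \<longlongrightarrow> l) at_top"
  proof (rule order_tendstoI)
    fix a assume "a < l"
    then obtain s where "s \<in> S" "a < s" using less_cSup_iff[OF ne bdd] by (auto simp: l_def)
    then show "\<forall>\<^sub>F t in at_top. a < v t" using down[of s a] by (simp add: S_def)
  next
    fix a assume "l < a"
    \<comment> \<open>At most two levels escape the dichotomy, so a usable one lies between l and
      a.\<close>
    then have "infinite {l<..<a}" by simp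
    moreover have "finite {x. x\<^sup>2 = 2 * q}"
      using q finite_subset[of "{x. x\<^sup>2 = 2 * q}" "{sqrt (2*q), - sqrt (2 * q)}"]
      by (smt (verit) finite.emptyI finite.insertI insertCI mem_Collect_eq power2_eq_iff real_sqrt_pow2 subsetI)
    ultimately obtain x where x: "l < x" "x < a" "x\<^sup>2 \<noteq> 2 * q"
      by (metis (mono_tags, lifting) finite_subset greaterThanLessThan_iff mem_Collect_eq subsetI)
    have "x \<notin> S" using x(1) cSup_upper[OF _ bdd, of x] by (auto simp: l_def)
    then show "\<forall>\<^sub>F t in at_top. v t < a" using dich[OF x(3)] x(2) by (auto elim: eventually_mono)
  qed
  then show ?thesis by blast
qed

section \<open>The reduced equation on (-1, 1)\<close>

lemma tanh_artanh_real:
  fixes x :: real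
  assumes "-1 < x" "x < 1"
  shows "tanh (artanh x) = x"
proof -
  have E: "exp (- 2 * artanh x) = (1 - x) / (1 + x)"
    using assms by (simp add: artanh_def exp_minus inverse_eq_divide)
  show ?thesis unfolding tanh_real_altdef E using assms by (simp add: field_simps)
qed

lemma ode_solD:
  assumes "ode_sol c U" "-1 < x" "x < 1"
  shows "(U has_real_derivative (Pc c x - 2 * x * U x - (U x)\<^sup>2 / 2) / (1 - x\<^sup>2)) (at x)"
proof -
  have "x\<^sup>2 < 1" using assms(2,3) by (simp add: abs_square_less_1 abs_less_iff)
  moreover obtain D where D: "(U has_real_derivative D) (at x)"
    "(1 - x\<^sup>2) * D + 2 * x * U x + (1/2) * (U x)\<^sup>2 = Pc c x"
    using assms unfolding ode_sol_def by (meson greaterThanLessThan_iff)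
  moreover from this have "D * (1 - x\<^sup>2) = Pc c x - 2 * x * U x - (U x)\<^sup>2 / 2"
    by (simp add: algebra_simps)
  ultimately have "D = (Pc c x - 2 * x * U x - (U x)\<^sup>2 / 2) / (1 - x\<^sup>2)"
    by (simp add: eq_divide_eq)
  with D show ?thesis by simp
qed

lemma ode_sol_cong:
  assumes "ode_sol c U" "\<And>x. -1 < x \<Longrightarrow> x < 1 \<Longrightarrow> V x = U x"
  shows "ode_sol c V"
  unfolding ode_sol_def
proof
  fix x :: real assume x: "x \<in> {-1<..<1}"
  then obtain D where D: "(U has_real_derivative D) (at x)"
    "(1 - x\<^sup>2) * D + 2 * x * U x + (1/2) * (U x)\<^sup>2 = Pc c x"
    using assms(1) unfolding ode_sol_def by blast
  have "(V has_real_derivative D) (at x)"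
    by (rule has_field_derivative_transform_within_open[OF D(1), of "{-1<..<1}"]) (use x assms(2) in auto)
  then show "\<exists>D. (V has_real_derivative D) (at x) \<and> (1 - x\<^sup>2) * D + 2 * x * V x + (1/2) * (V x)\<^sup>2 = Pc c x"
    using D(2) assms(2)[of x] x by auto
qed

lemma ode_sol_imp_riccati:
  assumes "ode_sol c U"
  shows "riccati (\<lambda>t. Pc c (tanh t) + 2) (\<lambda>t. U (tanh t) + 2 * tanh t)"
  unfolding riccati_def
proof
  fix t :: real
  have x: "-1 < tanh t" "tanh t < 1" using tanh_real_bounds[of t] by auto
  then have "(tanh t)\<^sup>2 < 1" by (simp add: abs_square_less_1 abs_less_iff)
  then have nz: "1 - (tanh t)\<^sup>2 \<noteq> 0" by simp
  have T: "(tanh has_real_derivative 1 - (tanh t)\<^sup>2) (at t)"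
    by (auto intro!: derivative_eq_intros)
  have "((\<lambda>t. U (tanh t) + 2 * tanh t) has_real_derivative
      (Pc c (tanh t) - 2 * tanh t * U (tanh t) - (U (tanh t))\<^sup>2 / 2) / (1 - (tanh t)\<^sup>2) *
      (1 - (tanh t)\<^sup>2) + 2 * (1 - (tanh t)\<^sup>2)) (at t)"
    by (intro DERIV_add DERIV_cmult T DERIV_chain2[OF ode_solD[OF assms x] T])
  also have "(Pc c (tanh t) - 2 * tanh t * U (tanh t) - (U (tanh t))\<^sup>2 / 2) / (1 - (tanh t)\<^sup>2) *
      (1 - (tanh t)\<^sup>2) + 2 * (1 - (tanh t)\<^sup>2)
      = Pc c (tanh t) + 2 - (U (tanh t) + 2 * tanh t)\<^sup>2 / 2"
    unfolding nonzero_eq_divide_eq[OF nz, THEN iffD1, OF refl]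
    by (simp add: power2_eq_square algebra_simps)
  finally show "((\<lambda>t. U (tanh t) + 2 * tanh t) has_real_derivative
      Pc c (tanh t) + 2 - (U (tanh t) + 2 * tanh t)\<^sup>2 / 2) (at t)" .
qed

lemma riccati_imp_ode_sol:
  assumes "riccati (\<lambda>t. Pc c (tanh t) + 2) v"
  shows "ode_sol c (\<lambda>x. v (artanh x) - 2 * x)"
  unfolding ode_sol_def
proof
  fix x :: real assume "x \<in> {-1<..<1}"
  then have x: "\<bar>x\<bar> < 1" "-1 < x" "x < 1" by auto
  then have "x\<^sup>2 < 1" by (simp add: abs_square_less_1)
  then have nz: "1 - x\<^sup>2 \<noteq> 0" by simp
  have "(artanh has_real_derivative 1 / (1 - x\<^sup>2)) (at x)"
    using x by (auto intro!: derivative_eq_intros)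
  from DERIV_chain2[where f = v and g = artanh, OF riccatiD[OF assms, of "artanh x"] this]
  have "((\<lambda>x. v (artanh x)) has_real_derivative
      (Pc c x + 2 - (v (artanh x))\<^sup>2 / 2) * (1 / (1 - x\<^sup>2))) (at x)"
    by (simp add: tanh_artanh_real x)
  then have "((\<lambda>x. v (artanh x) - 2 * x) has_real_derivative
      (Pc c x + 2 - (v (artanh x))\<^sup>2 / 2) * (1 / (1 - x\<^sup>2)) - 2) (at x)"
    by (auto intro!: derivative_eq_intros)
  moreover have "(1 - x\<^sup>2) * ((Pc c x + 2 - (v (artanh x))\<^sup>2 / 2) * (1 / (1 - x\<^sup>2)) - 2)
      + 2 * x * (v (artanh x) - 2 * x) + (1/2) * (v (artanh x) - 2 * x)\<^sup>2 = Pc c x"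
  proof -
    have "m * (e * (1 / m) - 2) = e - 2 * m" if "m \<noteq> 0" for m e :: real
      using that by (simp add: right_diff_distrib)
    note e = this[OF nz]
    show ?thesis unfolding e by (simp add: power2_eq_square algebra_simps)
  qed
  ultimately show "\<exists>D. ((\<lambda>x. v (artanh x) - 2 * x) has_real_derivative D) (at x) \<and>
      (1 - x\<^sup>2) * D + 2 * x * (v (artanh x) - 2 * x) + (1/2) * (v (artanh x) - 2 * x)\<^sup>2 = Pc c x"
    by blast
qed

lemma ode_sol_max:
  assumes "ode_sol c U"
  shows "\<exists>W. ode_sol c W \<and> (\<forall>V. ode_sol c V \<longrightarrow> (\<forall>x\<in>{-1<..<1}. V x \<le> W x))"
proof -
  obtain w where w: "riccati (\<lambda>t. Pc c (tanh t) + 2) w"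
    and max: "\<And>v t. riccati (\<lambda>t. Pc c (tanh t) + 2) v \<Longrightarrow> v t \<le> w t"
    using riccati_max[OF ode_sol_imp_riccati[OF assms]] by blast
  have "V x \<le> w (artanh x) - 2 * x" if "ode_sol c V" "x \<in> {-1<..<1}" for V x
    using max[OF ode_sol_imp_riccati[OF that(1)], of "artanh x"] that(2) by (simp add: tanh_artanh_real)
  then show ?thesis using riccati_imp_ode_sol[OF w] by blast
qed

lemma ode_sol_min:
  assumes "ode_sol c U"
  shows "\<exists>W. ode_sol c W \<and> (\<forall>V. ode_sol c V \<longrightarrow> (\<forall>x\<in>{-1<..<1}. W x \<le> V x))"
proof -
  obtain w where w: "riccati (\<lambda>t. Pc c (tanh t) + 2) w"
    and min: "\<And>v t. riccati (\<lambda>t. Pc c (tanh t) + 2) v \<Longrightarrow> w t \<le> v t"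
    using riccati_min[OF ode_sol_imp_riccati[OF assms]] by blast
  have "w (artanh x) - 2 * x \<le> V x" if "ode_sol c V" "x \<in> {-1<..<1}" for V x
    using min[OF ode_sol_imp_riccati[OF that(1)], of "artanh x"] that(2) by (simp add: tanh_artanh_real)
  then show ?thesis using riccati_imp_ode_sol[OF w] by blast
qed

text \<open>One arbitrary solution suffices to make the choice in \<open>U_plus\<close> meaningful,
  since a maximal solution then exists.\<close>

lemma ode_sol_U_plus:
  assumes "ode_sol c U"
  shows "ode_sol c (U_plus c)" "ode_sol c V \<Longrightarrow> V 0 \<le> gamma_plus c"
proof -
  have "ode_sol c (U_plus c) \<and> (\<forall>V. ode_sol c V \<longrightarrow> (\<forall>x\<in>{-1<..<1}. V x \<le> U_plus c x))"
    unfolding U_plus_def by (rule someI_ex[OF ode_sol_max[OF assms]])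
  then show "ode_sol c (U_plus c)" "ode_sol c V \<Longrightarrow> V 0 \<le> gamma_plus c"
    by (auto simp: gamma_plus_def)
qed

lemma ode_sol_U_minus:
  assumes "ode_sol c U"
  shows "ode_sol c (U_minus c)" "ode_sol c V \<Longrightarrow> gamma_minus c \<le> V 0"
proof -
  have "ode_sol c (U_minus c) \<and> (\<forall>V. ode_sol c V \<longrightarrow> (\<forall>x\<in>{-1<..<1}. U_minus c x \<le> V x))"
    unfolding U_minus_def by (rule someI_ex[OF ode_sol_min[OF assms]])
  then show "ode_sol c (U_minus c)" "ode_sol c V \<Longrightarrow> gamma_minus c \<le> V 0"
    by (auto simp: gamma_minus_def)
qed

lemma ode_sol_between:
  assumes "ode_sol c V" "ode_sol c W" "V 0 \<le> g" "g \<le> W 0"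
  shows "\<exists>U. ode_sol c U \<and> U 0 = g"
proof -
  obtain w where "riccati (\<lambda>t. Pc c (tanh t) + 2) w" "w 0 = g"
    using riccati_between[OF assms(1,2)[THEN ode_sol_imp_riccati], of g] assms(3,4) by auto
  then show ?thesis using riccati_imp_ode_sol by fastforce
qed

lemma ode_sol_unique:
  assumes "ode_sol c U" "ode_sol c V" "V 0 = U 0" "-1 < x" "x < 1"
  shows "V x = U x"
proof -
  have "(\<lambda>t. V (tanh t) + 2 * tanh t) = (\<lambda>t. U (tanh t) + 2 * tanh t)"
    by (rule riccati_unique[OF assms(1,2)[THEN ode_sol_imp_riccati]]) (use assms(3) in simp)
  from fun_cong[OF this, of "artanh x"] show ?thesis using assms(4,5) by (simp add: tanh_artanh_real)
qed

text \<open>This symmetry carries the analysis at the endpoint 1 over to -1, with c1 and c2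
  exchanged.\<close>

lemma ode_sol_reflect:
  assumes "ode_sol (c1, c2, c3) U"
  shows "ode_sol (c2, c1, c3) (\<lambda>x. - U (- x))"
  unfolding ode_sol_def
proof
  fix x :: real assume "x \<in> {-1<..<1}"
  then have "- x \<in> {-1<..<1}" by simp
  then obtain D where D: "(U has_real_derivative D) (at (- x))"
    "(1 - (- x)\<^sup>2) * D + 2 * (- x) * U (- x) + (1/2) * (U (- x))\<^sup>2 = Pc (c1, c2, c3) (- x)"
    using assms unfolding ode_sol_def by blast
  have "((\<lambda>x. - U (- x)) has_real_derivative D) (at x)"
    using DERIV_minus[OF DERIV_chain2[OF D(1) DERIV_minus[OF DERIV_ident]]] by simp
  moreover have "Pc (c2, c1, c3) x = Pc (c1, c2, c3) (- x)" by (simp add: Pc_def)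
  ultimately show "\<exists>D. ((\<lambda>x. - U (- x)) has_real_derivative D) (at x) \<and>
      (1 - x\<^sup>2) * D + 2 * x * (- U (- x)) + (1/2) * (- U (- x))\<^sup>2 = Pc (c2, c1, c3) x"
    using D(2) by auto
qed

lemma ode_sol_at_1:
  assumes "ode_sol (c1, c2, c3) U"
  shows "c2 \<ge> -1" "\<exists>l. (U \<longlongrightarrow> l) (at_left 1)"
proof -
  let ?v = "\<lambda>t. U (tanh t) + 2 * tanh t"
  note v = ode_sol_imp_riccati[OF assms]
  have "((\<lambda>t. Pc (c1, c2, c3) (tanh t) + 2) \<longlongrightarrow>
      c1 * (1 - 1) + c2 * (1 + 1) + c3 * (1 - 1\<^sup>2) + 2) at_top"
    unfolding Pc_def prod.case by (intro tendsto_intros tanh_real_at_top)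
  then have Q: "((\<lambda>t. Pc (c1, c2, c3) (tanh t) + 2) \<longlongrightarrow> c2 * 2 + 2) at_top" by simp
  show "c2 \<ge> -1" using riccati_limit_nonneg[OF v Q] by simp
  obtain l where "(?v \<longlongrightarrow> l) at_top" using riccati_converges[OF v Q] by blast
  from filterlim_compose[OF this artanh_real_at_left_1]
  have "((\<lambda>x. U (tanh (artanh x)) + 2 * tanh (artanh x)) \<longlongrightarrow> l) (at_left 1)" .
  moreover have "\<forall>\<^sub>F x in at_left (1::real). x \<in> {-1<..<1}"
    by (rule eventually_at_leftI[of "-1"]) auto
  then have "\<forall>\<^sub>F x in at_left 1. U (tanh (artanh x)) + 2 * tanh (artanh x) = U x + 2 * x"
    by eventually_elim (simp add: tanh_artanh_real)
  ultimately have "((\<lambda>x. U x + 2 * x) \<longlongrightarrow> l) (at_left 1)" by (rule Lim_transform_eventually)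
  then have "((\<lambda>x. U x + 2 * x - 2 * x) \<longlongrightarrow> l - 2 * 1) (at_left 1)" by (intro tendsto_intros)
  then show "\<exists>l. (U \<longlongrightarrow> l) (at_left 1)" by auto
qed

lemma ode_sol_at_minus_1:
  assumes "ode_sol (c1, c2, c3) U"
  shows "c1 \<ge> -1" "\<exists>l. (U \<longlongrightarrow> l) (at_right (-1))"
proof -
  note r = ode_sol_at_1[OF ode_sol_reflect[OF assms]]
  show "c1 \<ge> -1" by (rule r(1))
  obtain l where "((\<lambda>x. - U (- x)) \<longlongrightarrow> l) (at_left 1)" using r(2) by blast
  then have "((\<lambda>x. - U (- x)) \<longlongrightarrow> l) (at_left (- (- 1)))" by simp
  then have "((\<lambda>x. - U x) \<longlongrightarrow> l) (at_right (-1))" unfolding filterlim_at_left_to_right by simp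
  then have "((\<lambda>x. - (- U x)) \<longlongrightarrow> - l) (at_right (-1))" by (intro tendsto_intros)
  then show "\<exists>l. (U \<longlongrightarrow> l) (at_right (-1))" by auto
qed

text \<open>For \<open>c3 = c3bar c1 c2\<close> the equation has the explicit solution \<open>U0 = (1+a)(1-x) - (1+b)(1+x)\<close>.
  If \<open>c3\<close> were smaller, the difference \<open>U - U0\<close> weighted by \<open>h\<close> would be a global solution of
  \<open>G' < - k G\<^sup>2\<close>.\<close>

lemma ode_sol_imp_c3bar_le:
  assumes U: "ode_sol (c1, c2, c3) U"
  shows "c3bar c1 c2 \<le> c3"
proof (rule ccontr)
  assume "\<not> c3bar c1 c2 \<le> c3"
  then have neg: "c3 - c3bar c1 c2 < 0" (is "?\<delta> < 0") by simp
  define a where "a = sqrt (1 + c1)"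
  define b where "b = sqrt (1 + c2)"
  have ab: "a \<ge> 0" "b \<ge> 0" "c1 = a\<^sup>2 - 1" "c2 = b\<^sup>2 - 1"
    using ode_sol_at_1[OF U] ode_sol_at_minus_1[OF U] by (auto simp: a_def b_def)
  define v where "v t = U (tanh t) + 2 * tanh t" for t
  define v0 where "v0 t = a * (1 - tanh t) - b * (1 + tanh t)" for t :: real
  \<comment> \<open>\<open>v0\<close> is \<open>U0 + 2 * x\<close> in the variable t, and h is
    \<open>(1 + x) powr a * (1 - x) powr b\<close>, a solution of h' = v0 h. Multiplying by h
    removes the term linear in v - v0 from the equation for the difference.\<close>
  define h where "h t = exp (a * ln (1 + tanh t) + b * ln (1 - tanh t))" for t :: real
  have x: "-1 < tanh t" "tanh t < 1" "1 - (tanh t)\<^sup>2 > 0" for t :: real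
    using tanh_real_bounds[of t] by (auto simp: abs_square_less_1 abs_less_iff)
  have v': "(v has_real_derivative Pc (c1, c2, c3) (tanh t) + 2 - (v t)\<^sup>2 / 2) (at t)" for t
    using riccatiD[OF ode_sol_imp_riccati[OF U], of t] by (simp add: v_def[abs_def])
  have v0': "(v0 has_real_derivative - (a + b) * (1 - (tanh t)\<^sup>2)) (at t)" for t
    unfolding v0_def by (auto intro!: derivative_eq_intros simp: algebra_simps)
  have h': "(h has_real_derivative v0 t * h t) (at t)" for t
  proof -
    have e: "1 - (tanh t)\<^sup>2 = (1 + tanh t) * (1 - tanh t)"
      by (simp add: power2_eq_square algebra_simps)
    have "((\<lambda>t. ln (1 + tanh t)) has_real_derivative (1 - (tanh t)\<^sup>2) / (1 + tanh t)) (at t)"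
      "((\<lambda>t. ln (1 - tanh t)) has_real_derivative - ((1 - (tanh t)\<^sup>2) / (1 - tanh t))) (at t)"
      using x[of t] by (auto intro!: derivative_eq_intros simp: minus_divide_left)
    then have "((\<lambda>t. ln (1 + tanh t)) has_real_derivative 1 - tanh t) (at t)"
      "((\<lambda>t. ln (1 - tanh t)) has_real_derivative - (1 + tanh t)) (at t)"
      unfolding e using x[of t] by auto
    then have "(h has_real_derivative exp (a * ln (1 + tanh t) + b * ln (1 - tanh t)) *
        (a * (1 - tanh t) + b * (- (1 + tanh t)))) (at t)"
      unfolding h_def by (intro DERIV_fun_exp DERIV_add DERIV_cmult)
    then show ?thesis by (simp add: h_def v0_def algebra_simps)
  qed
  have "2 * c3bar c1 c2 = - (a + b) * (a + b + 2)" by (simp add: c3bar_def a_def b_def algebra_simps)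
  \<comment> \<open>The right-hand side for \<open>c3bar c1 c2\<close> is v0' + v0^2 / 2; the
    deviation of c3 contributes only a multiple of 1 - x^2. Doubling clears the denominators for
    \<open>algebra\<close>.\<close>
  then have q: "2 * ((a\<^sup>2 - 1) * (1 - x) + (b\<^sup>2 - 1) * (1 + x) + c3 * (1 - x\<^sup>2) + 2) =
      2 * (- (a + b) * (1 - x\<^sup>2)) + (a * (1 - x) - b * (1 + x))\<^sup>2 + 2 * (?\<delta> * (1 - x\<^sup>2))" for x :: real
    by algebra
  have Q: "Pc (c1, c2, c3) x + 2 =
      - (a + b) * (1 - x\<^sup>2) + (a * (1 - x) - b * (1 + x))\<^sup>2 / 2 + ?\<delta> * (1 - x\<^sup>2)" for x :: real
    unfolding Pc_def prod.case ab(3,4)[symmetric] using q[of x, folded ab(3,4)] by (simp add: field_simps)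
  define G where "G t = h t * (v t - v0 t)" for t
  define G' where "G' t = h t * (?\<delta> * (1 - (tanh t)\<^sup>2)) - h t * (v t - v0 t)\<^sup>2 / 2" for t
  have derG: "(G has_real_derivative G' t) (at t)" for t
  proof -
    have "(G has_real_derivative v0 t * h t * (v t - v0 t) +
        (Pc (c1, c2, c3) (tanh t) + 2 - (v t)\<^sup>2 / 2 - (- (a + b) * (1 - (tanh t)\<^sup>2))) * h t) (at t)"
      unfolding G_def by (rule derivative_eq_intros h' v' v0' refl)+
    also have "v0 t * h t * (v t - v0 t) +
        (Pc (c1, c2, c3) (tanh t) + 2 - (v t)\<^sup>2 / 2 - (- (a + b) * (1 - (tanh t)\<^sup>2))) * h t = G' t"
      unfolding Q[of "tanh t"] v0_def[symmetric] G'_def by (simp add: power2_eq_square field_simps)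
    finally show ?thesis .
  qed
  \<comment> \<open>Since h is at most 2 to the power a + b, the term
    \<open>h * (v - v0)^2 / 2\<close>, which is \<open>G^2 / (2 * h)\<close>, dominates
    \<open>k * G^2\<close>.\<close>
  define k where "k = 1 / (2 * exp ((a + b) * ln 2))"
  have "k * h t \<le> 1 / 2" for t
  proof -
    have "a * ln (1 + tanh t) + b * ln (1 - tanh t) \<le> a * ln 2 + b * ln 2"
      using x[of t] ab by (intro add_mono mult_left_mono) auto
    then have "h t \<le> exp ((a + b) * ln 2)" by (simp add: h_def algebra_simps)
    then show ?thesis by (simp add: k_def field_simps)
  qed
  then have k: "(k * h t) * (h t * (v t - v0 t)\<^sup>2) \<le> (1 / 2) * (h t * (v t - v0 t)\<^sup>2)" for t
    by (intro mult_right_mono) (auto simp: h_def)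
  have neg': "h t * (?\<delta> * (1 - (tanh t)\<^sup>2)) < 0" for t
    using neg x(3)[of t] by (simp add: h_def mult_less_0_iff)
  have le: "G' t \<le> - k * (G t)\<^sup>2" for t
  proof -
    have "k * (G t)\<^sup>2 = (k * h t) * (h t * (v t - v0 t)\<^sup>2)" by (simp add: G_def power2_eq_square)
    also have "\<dots> \<le> h t * (v t - v0 t)\<^sup>2 / 2" using k[of t] by simp
    finally show ?thesis using neg'[of t] by (simp add: G'_def)
  qed
  have "k > 0" by (simp add: k_def)
  from quadratic_decay_on_line[OF this derG le] have G0: "G = (\<lambda>_. 0)" by blast
  \<comment> \<open>A vanishing G contradicts the strictly negative source term in G'.\<close>
  have "G' 0 = 0" by (rule DERIV_unique[OF derG]) (simp add: G0)
  moreover have "v 0 - v0 0 = 0" using fun_cong[OF G0, of 0] by (simp add: G_def h_def)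
  ultimately show False using neg'[of 0] by (auto simp: G'_def)
qed

lemma ode_sol_imp_Jset:
  assumes "ode_sol c U"
  shows "c \<in> Jset"
proof -
  obtain c1 c2 c3 where c: "c = (c1, c2, c3)" by (cases c)
  show ?thesis
    using ode_sol_at_1(1)[OF assms[unfolded c]] ode_sol_at_minus_1(1)[OF assms[unfolded c]]
      ode_sol_imp_c3bar_le[OF assms[unfolded c]] by (simp add: Jset_def c)
qed

lemma ode_sol_imp_Iset:
  assumes "ode_sol c U"
  shows "(c, U 0) \<in> Iset"
  using ode_sol_imp_Jset[OF assms] ode_sol_U_plus(2)[OF assms assms] ode_sol_U_minus(2)[OF assms assms]
  by (simp add: Iset_def)

section \<open>Existence of solutions by a hypergeometric series\<close>

text \<open>Comparing coefficients of y^n gives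
  \<open>(n + 1) * (n + A) * a (n + 1) = num n * a n\<close>. In the usual notation num n is (n +
  \<alpha>) (n + \<beta>) with \<alpha> + \<beta> = A + B - 1 and \<alpha> \<beta> = d. These
  parameters may be complex, whereas the unfactored form stays real and is visibly nonnegative for d
  \<ge> 0.\<close>

lemma hypergeometric_solution:
  fixes A B d :: real
  assumes A: "A \<ge> 1" and B: "B \<ge> 0" and d: "d \<ge> 0"
  obtains f f' f'' :: "real \<Rightarrow> real" where
    "\<forall>y\<in>{0<..<1}. f y > 0 \<and> (f has_real_derivative f' y) (at y) \<and> (f' has_real_derivative f'' y) (at y) \<and>
      y * (1 - y) * f'' y + (A - (A + B) * y) * f' y = d * f y"
proof -
  define num where "num k = real k * (real k - 1) + (A + B) * real k + d" for k :: nat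
  define a where "a n = (\<Prod>k<n. num k / ((real k + 1) * (real k + A)))" for n
  have "real k * (real k - 1) \<ge> 0" for k :: nat by (cases k) auto
  then have num: "num k \<ge> 0" for k using A B d by (simp add: num_def)
  have a0: "a 0 = 1" by (simp add: a_def)
  have a_nonneg: "a n \<ge> 0" for n
    using num A unfolding a_def by (intro prod_nonneg) auto
  have a_Suc: "a (Suc n) = a n * (num n / ((real n + 1) * (real n + A)))" for n by (simp add: a_def)
  have rec: "(real n + 1) * (real n + A) * a (Suc n) = num n * a n" for n
    using A by (simp add: a_Suc)
  \<comment> \<open>The bound tends to 1, so the series converges for all |z| < 1.\<close>
  have ratio: "num n / ((real n + 1) * (real n + A)) \<le> 1 + (B + d) * inverse (real (Suc n))" for n
  proof -
    have "num n \<le> (real n + 1) * (real n + A) + (B + d) * (real n + A)"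
    proof -
      have "d * 1 \<le> d * (real n + A)" using A d by (intro mult_left_mono) auto
      moreover have "B * real n \<le> B * (real n + A)" using A B by (intro mult_left_mono) auto
      ultimately show ?thesis using A by (simp add: num_def algebra_simps)
    qed
    then have "num n / ((real n + 1) * (real n + A))
        \<le> ((real n + 1) * (real n + A) + (B + d) * (real n + A)) / ((real n + 1) * (real n + A))"
      using A by (intro divide_right_mono) auto
    also have "\<dots> = 1 + (B + d) * inverse (real (Suc n))"
      using A by (simp add: add_divide_distrib inverse_eq_divide add.commute)
    finally show ?thesis .
  qed
  have sm: "summable (\<lambda>n. a n * z ^ n)" if "norm z < 1" for z :: real
  proof -
    have "(\<lambda>n. \<bar>z\<bar> * (1 + (B + d) * inverse (real (Suc n)))) \<longlonglongrightarrow> \<bar>z\<bar> * (1 + (B + d) * 0)"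
      by (intro tendsto_intros LIMSEQ_inverse_real_of_nat)
    then have "\<forall>\<^sub>F n in sequentially. \<bar>z\<bar> * (1 + (B + d) * inverse (real (Suc n))) < (1 + \<bar>z\<bar>) / 2"
      using that by (intro order_tendstoD(2)) auto
    then obtain N where N: "\<And>n. n \<ge> N \<Longrightarrow> \<bar>z\<bar> * (1 + (B + d) * inverse (real (Suc n))) < (1 + \<bar>z\<bar>) / 2"
      by (auto simp: eventually_sequentially)
    show ?thesis
    proof (rule summable_ratio_test[of "(1 + \<bar>z\<bar>) / 2" N])
      show "(1 + \<bar>z\<bar>) / 2 < 1" using that by simp
      fix n assume "n \<ge> N"
      have "norm (a (Suc n) * z ^ Suc n) = a n * \<bar>z\<bar> ^ n * (\<bar>z\<bar> * (num n / ((real n + 1) * (real n + A))))"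
        using num[of n] a_nonneg[of n] A by (simp add: a_Suc abs_mult power_abs)
      also have "\<dots> \<le> a n * \<bar>z\<bar> ^ n * ((1 + \<bar>z\<bar>) / 2)"
      proof (rule mult_left_mono)
        show "\<bar>z\<bar> * (num n / ((real n + 1) * (real n + A))) \<le> (1 + \<bar>z\<bar>) / 2"
          by (rule order_trans[OF mult_left_mono[OF ratio[of n]]])
            (use N[OF \<open>n \<ge> N\<close>] in auto)
      qed (use a_nonneg[of n] in auto)
      also have "\<dots> = (1 + \<bar>z\<bar>) / 2 * norm (a n * z ^ n)"
        using a_nonneg[of n] by (simp add: abs_mult power_abs)
      finally show "norm (a (Suc n) * z ^ Suc n) \<le> (1 + \<bar>z\<bar>) / 2 * norm (a n * z ^ n)" .
    qed
  qed
  define f where "f z = (\<Sum>n. a n * z ^ n)" for z :: real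
  define f' where "f' z = (\<Sum>n. diffs a n * z ^ n)" for z :: real
  define f'' where "f'' z = (\<Sum>n. diffs (diffs a) n * z ^ n)" for z :: real
  have sm': "summable (\<lambda>n. diffs a n * z ^ n)" if "norm z < 1" for z :: real
    by (rule termdiff_converges[OF that sm])
  have sm'': "summable (\<lambda>n. diffs (diffs a) n * z ^ n)" if "norm z < 1" for z :: real
    by (rule termdiff_converges[OF that sm'])
  have "f y > 0 \<and> (f has_real_derivative f' y) (at y) \<and> (f' has_real_derivative f'' y) (at y) \<and>
      y * (1 - y) * f'' y + (A - (A + B) * y) * f' y = d * f y" if y: "0 < y" "y < 1" for y
  proof (intro conjI)
    have ny: "norm y < 1" using y by simp
    \<comment> \<open>On (0, 1) all terms are nonnegative, so f is at least its constant term
      1.\<close>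
    have "(\<Sum>n\<in>{0}. a n * y ^ n) \<le> f y"
      unfolding f_def by (rule sum_le_suminf) (use sm[OF ny] a_nonneg y in auto)
    then show "f y > 0" by (simp add: a0)
    show "(f has_real_derivative f' y) (at y)"
      unfolding f_def f'_def by (rule termdiffs_strong'[OF sm ny])
    show "(f' has_real_derivative f'' y) (at y)"
      unfolding f'_def f''_def by (rule termdiffs_strong'[OF sm' ny])
    have F: "(\<lambda>n. a n * y ^ n) sums f y"
      unfolding f_def by (rule summable_sums[OF sm[OF ny]])
    have F': "(\<lambda>n. (real n + 1) * a (Suc n) * y ^ n) sums f' y"
      using summable_sums[OF sm'[OF ny]] by (simp add: f'_def diffs_def add.commute)
    have yF': "(\<lambda>n. real n * a n * y ^ n) sums (y * f' y)"
    proof -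
      have "(\<lambda>n. y * (real n * a n * y ^ (n - Suc 0))) sums (y * f' y)"
        unfolding f'_def using diffs_equiv[OF sm'[OF ny]] by (intro sums_mult) simp
      moreover have "y * (real n * a n * y ^ (n - Suc 0)) = real n * a n * y ^ n" for n
        by (cases n) auto
      ultimately show ?thesis by simp
    qed
    have F'': "(\<lambda>n. real n * ((real n + 1) * a (Suc n)) * y ^ (n - Suc 0)) sums f'' y"
      using diffs_equiv[OF sm''[OF ny]] by (simp add: f''_def diffs_def[of a] add.commute)
    have yF'': "(\<lambda>n. real n * (real n + 1) * a (Suc n) * y ^ n) sums (y * f'' y)"
    proof -
      have "y * (real n * ((real n + 1) * a (Suc n)) * y ^ (n - Suc 0))
          = real n * (real n + 1) * a (Suc n) * y ^ n" for n
        by (cases n) auto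
      from sums_mult[OF F'', of y, unfolded this] show ?thesis .
    qed
    have yyF'': "(\<lambda>n. real n * (real n - 1) * a n * y ^ n) sums (y * (y * f'' y))"
    proof -
      have "(\<lambda>n. real (Suc n) * (real (Suc n) - 1) * a (Suc n) * y ^ Suc n) sums (y * (y * f'' y))"
        using sums_mult[OF yF'', of y] by (simp add: mult_ac add.commute)
      then show ?thesis using sums_Suc_iff[of "\<lambda>n. real n * (real n - 1) * a n * y ^ n"] by simp
    qed
    have "(\<lambda>n. real n * (real n + 1) * a (Suc n) * y ^ n - real n * (real n - 1) * a n * y ^ n
        + (A * ((real n + 1) * a (Suc n) * y ^ n) - (A + B) * (real n * a n * y ^ n)))
        sums (y * f'' y - y * (y * f'' y) + (A * f' y - (A + B) * (y * f' y)))"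
      by (intro sums_add sums_diff sums_mult yF'' yyF'' F' yF')
    moreover have "real n * (real n + 1) * a (Suc n) * y ^ n - real n * (real n - 1) * a n * y ^ n
        + (A * ((real n + 1) * a (Suc n) * y ^ n) - (A + B) * (real n * a n * y ^ n)) = d * (a n * y ^ n)" for n
    proof -
      have "real n * (real n + 1) * a (Suc n) * y ^ n - real n * (real n - 1) * a n * y ^ n
        + (A * ((real n + 1) * a (Suc n) * y ^ n) - (A + B) * (real n * a n * y ^ n))
        = ((real n + 1) * (real n + A) * a (Suc n) - (num n - d) * a n) * y ^ n"
        by (simp add: num_def algebra_simps)
      then show ?thesis unfolding rec by (simp add: algebra_simps)
    qed
    ultimately have "(\<lambda>n. d * (a n * y ^ n)) sums (y * f'' y - y * (y * f'' y) + (A * f' y - (A + B) * (y * f' y)))"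
      by simp
    from sums_unique2[OF this sums_mult[OF F]]
    show "y * (1 - y) * f'' y + (A - (A + B) * y) * f' y = d * f y" by (simp add: algebra_simps)
  qed
  then show ?thesis using that[of f f' f''] by auto
qed

text \<open>Writing \<open>U = U0 + 2 (1 - x\<^sup>2) (ln F)'\<close> for the explicit solution \<open>U0\<close> with \<open>c3 = c3bar c1 c2\<close>
  turns the equation into a hypergeometric equation for \<open>F\<close> in the variable \<open>y = (1 + x) / 2\<close>, whose
  power series has nonnegative coefficients, so that \<open>F\<close> does not vanish.\<close>

lemma ode_sol_exists:
  assumes "c \<in> Jset"
  shows "\<exists>U. ode_sol c U"
proof -
  obtain c1 c2 c3 where c: "c = (c1, c2, c3)" by (cases c)
  \<comment> \<open>A and B are the coefficients 1 + a and 1 + b of \<open>U0\<close>, and the third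
    condition of \<open>Jset\<close> is exactly d \<ge> 0.\<close>
  define A where "A = 1 + sqrt (1 + c1)"
  define B where "B = 1 + sqrt (1 + c2)"
  define d where "d = (c3 - c3bar c1 c2) / 2"
  have c1: "c1 \<ge> -1" and c2: "c2 \<ge> -1" and "c3 \<ge> c3bar c1 c2"
    using assms by (auto simp: c Jset_def)
  then have AB: "A \<ge> 1" "B \<ge> 0" "d \<ge> 0" by (auto simp: A_def B_def d_def)
  have cs: "c1 = (A - 1)\<^sup>2 - 1" "c2 = (B - 1)\<^sup>2 - 1" using c1 c2 by (auto simp: A_def B_def)
  have "c3 = 2 * d + c3bar c1 c2" by (simp add: d_def field_simps)
  then have cs3: "c3 = 2 * d - (A + B) * (A + B - 2) / 2" unfolding c3bar_def by (simp add: A_def B_def)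
  obtain f f' f'' where "\<forall>y\<in>{0<..<1}. f y > 0 \<and> (f has_real_derivative f' y) (at y) \<and>
      (f' has_real_derivative f'' y) (at y) \<and> y * (1 - y) * f'' y + (A - (A + B) * y) * f' y = d * f y"
    using hypergeometric_solution[OF AB] by blast
  then have f: "f y > 0" "(f has_real_derivative f' y) (at y)" "(f' has_real_derivative f'' y) (at y)"
    "y * (1 - y) * f'' y + (A - (A + B) * y) * f' y = d * f y" if "0 < y" "y < 1" for y
    using that by auto
  \<comment> \<open>The factor 2 in front of the logarithmic derivative cancels against dy/dx =
    1/2.\<close>
  define U where "U x = A * (1 - x) - B * (1 + x) + (1 - x\<^sup>2) * (f' ((1 + x) / 2) / f ((1 + x) / 2))" for x :: real
  have "ode_sol c U" unfolding ode_sol_def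
  proof
    fix x :: real assume "x \<in> {-1<..<1}"
    then have x: "-1 < x" "x < 1" by auto
    define y where "y = (1 + x) / 2"
    have y: "0 < y" "y < 1" using x by (auto simp: y_def)
    have xy: "x = 2 * y - 1" by (simp add: y_def field_simps)
    have dy: "((\<lambda>x. (1 + x) / 2) has_real_derivative 1 / 2) (at x)" by (auto intro!: derivative_eq_intros)
    have F: "((\<lambda>x. f ((1 + x) / 2)) has_real_derivative f' y * (1 / 2)) (at x)"
      by (rule DERIV_chain2[OF f(2)[OF y, unfolded y_def] dy, folded y_def])
    have F': "((\<lambda>x. f' ((1 + x) / 2)) has_real_derivative f'' y * (1 / 2)) (at x)"
      by (rule DERIV_chain2[OF f(3)[OF y, unfolded y_def] dy, folded y_def])
    have nz: "f y \<noteq> 0" using f(1)[OF y] by simp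
    define g where "g = f' y / f y"
    have f'y: "f' y = g * f y" using nz by (simp add: g_def)
    define g2 where "g2 = f'' y / f y"
    have f''y: "f'' y = g2 * f y" using nz by (simp add: g2_def)
    \<comment> \<open>After division by f the equation is solved for d. Substituting d turns the
      reduced equation into a polynomial identity in y, g, g2, A and B.\<close>
    have "(y * (1 - y) * g2 + (A - (A + B) * y) * g - d) * f y = 0"
      using f(4)[OF y] by (simp add: f'y f''y algebra_simps)
    then have eq: "d = y * (1 - y) * g2 + (A - (A + B) * y) * g" using nz by simp
    have "(U has_real_derivative - A - B - 2 * x * g +
        (1 - x\<^sup>2) * ((f'' y * (1 / 2) * f y - f' y * (f' y * (1 / 2))) / (f y * f y))) (at x)"
      unfolding U_def
      by (rule derivative_eq_intros F F' refl | use nz in \<open>simp add: y_def g_def\<close>)+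
    moreover have e: "(f'' y * (1 / 2) * f y - f' y * (f' y * (1 / 2))) / (f y * f y) = (g2 - g\<^sup>2) / 2"
      using nz by (simp add: f'y f''y field_simps power2_eq_square)
    ultimately have "(U has_real_derivative - A - B - 2 * x * g + (1 - x\<^sup>2) * ((g2 - g\<^sup>2) / 2)) (at x)"
      by (simp only: e)
    moreover have Ux: "U x = A * (1 - x) - B * (1 + x) + (1 - x\<^sup>2) * g"
      by (simp add: U_def g_def y_def)
    have "(1 - x\<^sup>2) * (- A - B - 2 * x * g + (1 - x\<^sup>2) * ((g2 - g\<^sup>2) / 2))
      + 2 * x * U x + (1/2) * (U x)\<^sup>2 = Pc c x"
      unfolding Ux unfolding c Pc_def prod.case cs(1,2) cs3 eq xy by (simp add: power2_eq_square field_simps)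
    ultimately show "\<exists>D. (U has_real_derivative D) (at x) \<and>
        (1 - x\<^sup>2) * D + 2 * x * U x + (1/2) * (U x)\<^sup>2 = Pc c x" by blast
  qed
  then show ?thesis by blast
qed

section \<open>Smoothness and continuity up to the endpoints\<close>

text \<open>The algebra generated by x, U and 1 / (1 - x^2) over the constants. The equation
  expresses U' within it, so it is closed under differentiation on (-1, 1) and contains all iterated
  derivatives of U there.\<close>

inductive_set ratfun :: "(real \<Rightarrow> real) \<Rightarrow> (real \<Rightarrow> real) set" for U where
  const: "(\<lambda>_. k) \<in> ratfun U"
| ident: "(\<lambda>x. x) \<in> ratfun U"
| base: "U \<in> ratfun U"
| recip: "(\<lambda>x. 1 / (1 - x\<^sup>2)) \<in> ratfun U"
| add: "f \<in> ratfun U \<Longrightarrow> g \<in> ratfun U \<Longrightarrow> (\<lambda>x. f x + g x) \<in> ratfun U"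
| mult: "f \<in> ratfun U \<Longrightarrow> g \<in> ratfun U \<Longrightarrow> (\<lambda>x. f x * g x) \<in> ratfun U"

lemma ratfun_derivative:
  assumes U: "ode_sol c U" and "g \<in> ratfun U"
  shows "\<exists>g'\<in>ratfun U. \<forall>x. -1 < x \<longrightarrow> x < 1 \<longrightarrow> (g has_real_derivative g' x) (at x)"
  using assms(2)
proof induction
  case (const k)
  show ?case by (rule bexI[OF _ ratfun.const[of 0]]) auto
next
  case ident
  show ?case by (rule bexI[OF _ ratfun.const[of 1]]) auto
next
  case base
  obtain c1 c2 c3 where c: "c = (c1, c2, c3)" by (cases c)
  define U' where "U' x = (c1 * (1 + (-1) * x) + c2 * (1 + x) + c3 * (1 + (-1) * (x * x)) + (-2) * (x * U x)
    + (-1/2) * (U x * U x)) * (1 / (1 - x\<^sup>2))" for x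
  have "U' \<in> ratfun U" unfolding U'_def[abs_def]
    by (rule ratfun.const ratfun.ident ratfun.base ratfun.recip ratfun.add ratfun.mult)+
  moreover have "U' x = (Pc c x - 2 * x * U x - (U x)\<^sup>2 / 2) / (1 - x\<^sup>2)" for x
  proof -
    have "c1 * (1 + (-1) * x) + c2 * (1 + x) + c3 * (1 + (-1) * (x * x)) + (-2) * (x * U x)
        + (-1/2) * (U x * U x) = Pc c x - 2 * x * U x - (U x)\<^sup>2 / 2"
      by (simp add: c Pc_def power2_eq_square)
    then show ?thesis unfolding U'_def by (simp only: times_divide_eq_right mult_1_right)
  qed
  ultimately show ?case using ode_solD[OF U] by (intro bexI[of _ U']) auto
next
  case recip
  have "(\<lambda>x. 2 * (x * ((1 / (1 - x\<^sup>2)) * (1 / (1 - x\<^sup>2))))) \<in> ratfun U"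
    by (rule ratfun.const ratfun.ident ratfun.recip ratfun.mult)+
  moreover have "((\<lambda>x. 1 / (1 - x\<^sup>2)) has_real_derivative 2 * (x * ((1 / (1 - x\<^sup>2)) * (1 / (1 - x\<^sup>2))))) (at x)"
    if "-1 < x" "x < 1" for x :: real
  proof -
    have "x\<^sup>2 < 1" using that by (simp add: abs_square_less_1 abs_less_iff)
    then have "1 - x\<^sup>2 \<noteq> 0" by simp
    moreover have "((\<lambda>x. 1 - x\<^sup>2) has_real_derivative - 2 * x) (at x)"
      by (auto intro!: derivative_eq_intros)
    ultimately show ?thesis using DERIV_divide[OF DERIV_const[of 1]] by fastforce
  qed
  ultimately show ?case by (auto intro!: bexI)
next
  case (add f g)
  then obtain f' g' where "f' \<in> ratfun U" "g' \<in> ratfun U"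
    "\<forall>x. -1 < x \<longrightarrow> x < 1 \<longrightarrow> (f has_real_derivative f' x) (at x)"
    "\<forall>x. -1 < x \<longrightarrow> x < 1 \<longrightarrow> (g has_real_derivative g' x) (at x)" by blast
  then show ?case
    by (intro bexI[of _ "\<lambda>x. f' x + g' x"] ratfun.add) (auto intro!: derivative_eq_intros)
next
  case (mult f g)
  then obtain f' g' where "f' \<in> ratfun U" "g' \<in> ratfun U"
    "\<forall>x. -1 < x \<longrightarrow> x < 1 \<longrightarrow> (f has_real_derivative f' x) (at x)"
    "\<forall>x. -1 < x \<longrightarrow> x < 1 \<longrightarrow> (g has_real_derivative g' x) (at x)" by blast
  with mult.hyps show ?case
    by (intro bexI[of _ "\<lambda>x. f' x * g x + g' x * f x"] ratfun.add ratfun.mult)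
      (auto intro!: derivative_eq_intros)
qed

lemma ode_sol_C_inf:
  assumes U: "ode_sol c U"
  shows "C_inf_on {-1<..<1} U"
proof -
  have "\<exists>g\<in>ratfun U. \<forall>x. -1 < x \<longrightarrow> x < 1 \<longrightarrow> (deriv ^^ n) U x = g x" for n
  proof (induction n)
    case 0
    show ?case using ratfun.base by (intro bexI[of _ U]) auto
  next
    case (Suc n)
    then obtain g where g: "g \<in> ratfun U" "\<And>x. -1 < x \<Longrightarrow> x < 1 \<Longrightarrow> (deriv ^^ n) U x = g x" by blast
    obtain g' where g': "g' \<in> ratfun U"
      "\<And>x. -1 < x \<Longrightarrow> x < 1 \<Longrightarrow> (g has_real_derivative g' x) (at x)"
      using ratfun_derivative[OF U g(1)] by blast
    have "((deriv ^^ n) U has_real_derivative g' x) (at x)" if "-1 < x" "x < 1" for x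
      by (rule has_field_derivative_transform_within_open[OF g'(2)[OF that], of "{-1<..<1}"])
        (use that g(2) in auto)
    then show ?case using g'(1) by (intro bexI[of _ g']) (auto intro: DERIV_imp_deriv)
  qed
  moreover have "f differentiable (at x)"
    if g: "g \<in> ratfun U" "\<forall>x. -1 < x \<longrightarrow> x < 1 \<longrightarrow> f x = g x" and x: "-1 < x" "x < 1" for f g x
  proof -
    obtain D where D: "(g has_real_derivative D) (at x)"
      using ratfun_derivative[OF U g(1)] x by blast
    have "(f has_real_derivative D) (at x)"
      by (rule has_field_derivative_transform_within_open[OF D, of "{-1<..<1}"]) (use g(2) x in auto)
    then show ?thesis using real_differentiable_def by blast
  qed
  ultimately show ?thesis unfolding C_inf_on_def by (metis greaterThanLessThan_iff)
qed

text \<open>\<open>ode_sol\<close> leaves the values of U at -1 and 1 arbitrary; replacing them by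
  the one-sided limits gives continuity on the closed interval without affecting the
  equation.\<close>

lemma ode_sol_extend:
  assumes U: "ode_sol c U"
  obtains W where "ode_sol c W" "continuous_on {-1..1} W" "\<And>x. -1 < x \<Longrightarrow> x < 1 \<Longrightarrow> W x = U x"
proof -
  obtain c1 c2 c3 where c: "c = (c1, c2, c3)" by (cases c)
  obtain r where r: "(U \<longlongrightarrow> r) (at_left 1)" using ode_sol_at_1(2) U c by blast
  obtain l where l: "(U \<longlongrightarrow> l) (at_right (-1))" using ode_sol_at_minus_1(2) U c by blast
  define W where "W x = (if x = -1 then l else if x = 1 then r else U x)" for x
  have W: "W x = U x" if "-1 < x" "x < 1" for x using that by (simp add: W_def)
  have sol: "ode_sol c W" by (rule ode_sol_cong[OF U W])
  have "continuous_on {-1..1} W"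
  proof (rule continuous_on_IccI)
    have "\<forall>\<^sub>F x in at_right (-1). U x = W x"
      by (rule eventually_at_rightI[of _ 1]) (auto simp: W)
    from Lim_transform_eventually[OF l this] show "(W \<longlongrightarrow> W (-1)) (at_right (-1))"
      by (simp add: W_def[of "-1"])
    have "\<forall>\<^sub>F x in at_left 1. U x = W x"
      by (rule eventually_at_leftI[of "-1"]) (auto simp: W)
    from Lim_transform_eventually[OF r this] show "(W \<longlongrightarrow> W 1) (at_left 1)"
      by (simp add: W_def[of 1])
    show "W \<midarrow>x\<rightarrow> W x" if "-1 < x" "x < 1" for x
      using ode_solD[OF sol that] DERIV_isCont isContD by blast
  qed simp
  then show ?thesis using that[of W] sol W by blast
qed

lemma continuous_on_eq_at_endpoints:
  fixes U V :: "real \<Rightarrow> real"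
  assumes "continuous_on {-1..1} U" "continuous_on {-1..1} V"
    and "\<And>x. -1 < x \<Longrightarrow> x < 1 \<Longrightarrow> V x = U x" and "x \<in> {-1..1}"
  shows "V x = U x"
proof -
  have "V x - U x = 0"
  proof (rule continuous_constant_on_closure[of "{-1<..<1}" "\<lambda>x. V x - U x" 0])
    show "continuous_on (closure {-1<..<1}) (\<lambda>x. V x - U x)"
      using assms(1,2) by (auto intro: continuous_intros)
  qed (use assms(3,4) in auto)
  then show ?thesis by simp
qed

lemma Iset_existence_uniqueness:
  assumes "(c, \<gamma>) \<in> Iset"
  shows "\<exists>U. C_inf_on {-1<..<1} U \<and> continuous_on {-1..1} U \<and> ode_sol c U \<and> U 0 = \<gamma> \<and>
    (\<forall>V. C_inf_on {-1<..<1} V \<and> continuous_on {-1..1} V \<and> ode_sol c V \<and> V 0 = \<gamma>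
      \<longrightarrow> (\<forall>x\<in>{-1..1}. V x = U x))"
proof -
  have J: "c \<in> Jset" and g: "U_minus c 0 \<le> \<gamma>" "\<gamma> \<le> U_plus c 0"
    using assms by (auto simp: Iset_def gamma_minus_def gamma_plus_def)
  obtain U0 where "ode_sol c U0" using ode_sol_exists[OF J] by blast
  then obtain U where U: "ode_sol c U" "U 0 = \<gamma>"
    using ode_sol_between[OF ode_sol_U_minus(1) ode_sol_U_plus(1) g] by blast
  obtain W where W: "ode_sol c W" "continuous_on {-1..1} W" "\<And>x. -1 < x \<Longrightarrow> x < 1 \<Longrightarrow> W x = U x"
    using ode_sol_extend[OF U(1)] by blast
  have W0: "W 0 = \<gamma>" using W(3)[of 0] U(2) by simp
  have "V x = W x" if "continuous_on {-1..1} V" "ode_sol c V" "V 0 = \<gamma>" "x \<in> {-1..1}" for V x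
    by (rule continuous_on_eq_at_endpoints[OF W(2) that(1) _ that(4)])
      (use ode_sol_unique[OF W(1) that(2)] W0 that(3) in auto)
  then show ?thesis using W W0 ode_sol_C_inf[OF W(1)] by blast
qed

section \<open>From the Navier-Stokes equations to the reduced equation\<close>

text \<open>Here \<open>s = cot \<theta>\<close>, and \<open>C s / sqrt (1 + s\<^sup>2)\<close> is \<open>U\<close> at \<open>x = cos \<theta> = s / sqrt (1 + s\<^sup>2)\<close>; the two
  equations are the first and third momentum equations at the point \<open>(1, 0, s)\<close>. The combination
  \<open>j3 - s * j1\<close> integrates to a formula for the pressure \<open>p\<close>, and with it \<open>j1 + s * j3\<close> says that
  \<open>A + (s C + C\<^sup>2 / 2) / (1 + s\<^sup>2)\<close> is a quadratic polynomial in \<open>x\<close>.\<close>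

lemma stream_function_imp_ode_sol:
  fixes C A A1 A2 p p1 :: "real \<Rightarrow> real"
  assumes C: "\<And>s. (C has_real_derivative A s) (at s)"
    and A: "\<And>s. (A has_real_derivative A1 s) (at s)"
    and A1: "\<And>s. (A1 has_real_derivative A2 s) (at s)"
    and p: "\<And>s. (p has_real_derivative p1 s) (at s)"
    and j1: "\<And>s. - (1 + s\<^sup>2) * A2 s - 3 * s * A1 s - (A s)\<^sup>2 - C s * A1 s - 2 * p s - s * p1 s = 0"
    and j3: "\<And>s. - (1 + s\<^sup>2) * (A1 s + s * A2 s) - 3 * s\<^sup>2 * A1 s - s * A s + C s - s * (A s)\<^sup>2 + C s * A s
      - s * C s * A1 s + p1 s = 0"
  shows "\<exists>c. ode_sol c (\<lambda>x. C (x / sqrt (1 - x\<^sup>2)) * sqrt (1 - x\<^sup>2))"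
proof -
  define L where "L s = (1 + s\<^sup>2) * p s - (1 + s\<^sup>2) * A s + s * C s + (C s)\<^sup>2 / 2" for s
  have "(L has_real_derivative 2 * s * p s + (1 + s\<^sup>2) * p1 s - 2 * s * A s - (1 + s\<^sup>2) * A1 s
      + C s + s * A s + C s * A s) (at s)" for s
    unfolding L_def by (auto intro!: derivative_eq_intros C A p simp: algebra_simps)
  moreover have "2 * s * p s + (1 + s\<^sup>2) * p1 s - 2 * s * A s - (1 + s\<^sup>2) * A1 s
      + C s + s * A s + C s * A s = 0" for s
    using j1[of s] j3[of s] by algebra
  ultimately have "(L has_real_derivative 0) (at s)" for s by metis
  then have "L s = L 0" for s using DERIV_isconst_all[of L s 0] by blast
  then obtain K where K: "\<And>s. (1 + s\<^sup>2) * p s - (1 + s\<^sup>2) * A s + s * C s + (C s)\<^sup>2 / 2 = K"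
    unfolding L_def by blast
  define r where "r s = sqrt (1 + s\<^sup>2)" for s :: real
  have r0: "r s > 0" for s by (simp add: r_def add_pos_nonneg)
  then have rnz: "r s \<noteq> 0" for s by (metis less_irrefl)
  have r2: "r s * r s = 1 + s\<^sup>2" for s by (simp add: r_def)
  have dr: "(r has_real_derivative s / r s) (at s)" for s
  proof -
    have "1 + s\<^sup>2 > 0" by (simp add: add_pos_nonneg)
    then show ?thesis unfolding r_def by (auto intro!: derivative_eq_intros simp: divide_simps)
  qed
  define X where "X s = s / r s" for s
  have dx: "(X has_real_derivative 1 / (r s * r s * r s)) (at s)" for s
  proof -
    have "(X has_real_derivative (1 * r s - s * (s / r s)) / (r s * r s)) (at s)"
      unfolding X_def by (rule DERIV_divide[OF DERIV_ident dr rnz])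
    also have "(1 * r s - s * (s / r s)) / (r s * r s) = (r s * r s - s\<^sup>2) / (r s * r s * r s)"
      using rnz[of s] by (simp add: field_simps power2_eq_square)
    finally show ?thesis by (simp add: r2)
  qed
  \<comment> \<open>With X' = 1 / r^3 and W the quantity
    \<open>A + (s * C + C^2 / 2) / (1 + s^2)\<close>, N is dW/dX + 2 K X. Its constancy says that
    the second derivative of W with respect to X is -2 K, which is why W is quadratic in X.\<close>
  define N where "N s = r s * r s * r s * A1 s + r s * (C s + s * A s + C s * A s)
    + (2 * K - 2 * s * C s - (C s)\<^sup>2) * X s" for s
  have dN: "(N has_real_derivative 0) (at s)" for s
  proof -
    let ?D = "3 * (s / r s) * (r s * r s) * A1 s + r s * r s * r s * A2 s
      + (s / r s * (C s + s * A s + C s * A s)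
      + r s * (A s + (A s + s * A1 s) + (A s * A s + C s * A1 s)))
      + ((- 2 * C s - 2 * s * A s - 2 * C s * A s) * X s
        + (2 * K - 2 * s * C s - (C s)\<^sup>2) * (1 / (r s * r s * r s)))"
    have "(N has_real_derivative ?D) (at s)"
      unfolding N_def by (auto intro!: derivative_eq_intros dr dx C A A1 simp: algebra_simps)
    moreover have "?D = 0"
    proof -
      \<comment> \<open>Naming the reciprocal, with the relation \<open>q * r s = 1\<close>, makes
        the goal a polynomial identity for \<open>algebra\<close>.\<close>
      define q where "q = inverse (r s)"
      have q: "q * r s = 1" using rnz[of s] by (simp add: q_def)
      have "3 * (s * q) * (r s * r s) * A1 s + r s * r s * r s * A2 s
        + (s * q * (C s + s * A s + C s * A s)
        + r s * (A s + (A s + s * A1 s) + (A s * A s + C s * A1 s)))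
        + ((- 2 * C s - 2 * s * A s - 2 * C s * A s) * (s * q)
          + (2 * K - 2 * s * C s - (C s)\<^sup>2) * (q * q * q)) = 0"
        using j1[of s] j3[of s] K[of s] r2[of s] q by algebra
      then show ?thesis by (simp add: q_def X_def divide_inverse)
    qed
    ultimately show ?thesis by metis
  qed
  define K2 where "K2 = N 0"
  have N: "N s = K2" for s
    unfolding K2_def using DERIV_isconst_all[of N s 0] dN by blast
  define W where "W s = A s + (s * C s + (C s)\<^sup>2 / 2) / (1 + s\<^sup>2)" for s
  have M: "1 + s\<^sup>2 \<noteq> 0" for s :: real by (simp add: add_nonneg_eq_0_iff)
  define Y where "Y s = W s - K2 * X s + K * (X s)\<^sup>2" for s
  have "(Y has_real_derivative 0) (at s)" for s
  proof -
    let ?D = "A1 s + ((C s + s * A s + C s * A s) * (1 + s\<^sup>2) - (s * C s + (C s)\<^sup>2 / 2) * (2 * s))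
        / ((1 + s\<^sup>2) * (1 + s\<^sup>2)) - K2 * (1 / (r s * r s * r s)) + K * (2 * X s * (1 / (r s * r s * r s)))"
    have "(Y has_real_derivative ?D) (at s)"
      unfolding Y_def W_def
      by (rule derivative_eq_intros dx C A refl M | simp add: M mult_ac add_ac)+
    moreover have "?D = 0"
    proof -
      define q where "q = inverse (r s)"
      have q: "q * r s = 1" using rnz[of s] by (simp add: q_def)
      have m: "inverse (1 + s\<^sup>2) = q * q" by (simp add: r2[symmetric] q_def)
      have N': "r s * r s * r s * A1 s + r s * (C s + s * A s + C s * A s)
        + (2 * K - 2 * s * C s - (C s)\<^sup>2) * (s * q) = K2"
        using N[of s] by (simp add: N_def X_def q_def divide_inverse)
      have "2 * A1 s + (2 * (C s + s * A s + C s * A s) * (r s * r s) - (2 * s * C s + (C s)\<^sup>2) * (2 * s))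
        * (q * q * (q * q)) - 2 * K2 * (q * q * q) + 2 * K * (2 * (s * q) * (q * q * q)) = 0"
        unfolding N'[symmetric] using q by algebra
      then show ?thesis
        unfolding divide_inverse inverse_mult_distrib m X_def q_def[symmetric] r2[symmetric]
        by (simp add: algebra_simps)
    qed
    ultimately show ?thesis by metis
  qed
  then have Y: "Y s = Y 0" for s using DERIV_isconst_all[of Y s 0] by blast
  define K3 where "K3 = Y 0"
  have W: "A s + (s * C s + (C s)\<^sup>2 / 2) / (1 + s\<^sup>2) = K3 + K2 * (s / r s) - K * (s / r s)\<^sup>2" for s
    using Y[of s] by (simp add: Y_def K3_def W_def X_def)
  \<comment> \<open>The constants come from matching coefficients: c1 + c2 + c3 = K3, c2 - c1 = K2
    and c3 = K.\<close>
  have "ode_sol ((K3 - K - K2) / 2, (K3 - K + K2) / 2, K) (\<lambda>x. C (x / sqrt (1 - x\<^sup>2)) * sqrt (1 - x\<^sup>2))"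
    unfolding ode_sol_def
  proof
    fix x :: real assume "x \<in> {-1<..<1}"
    then have x: "x\<^sup>2 < 1" by (simp add: abs_square_less_1 abs_less_iff)
    define q where "q = sqrt (1 - x\<^sup>2)"
    have q: "q > 0" "q * q = 1 - x\<^sup>2" using x by (simp_all add: q_def)
    have nz: "q \<noteq> 0" "1 - x\<^sup>2 \<noteq> 0" using q x by auto
    define s where "s = x / q"
    have M1: "1 + s\<^sup>2 = 1 / (q * q)" using nz q(2) by (simp add: s_def field_simps power2_eq_square)
    have rs: "r s = 1 / q" unfolding r_def M1 using q(1) by (simp add: real_sqrt_divide)
    have sr: "s / r s = x" unfolding rs using nz by (simp add: s_def)
    have dq: "((\<lambda>x. sqrt (1 - x\<^sup>2)) has_real_derivative - x / q) (at x)"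
      using x unfolding q_def by (auto intro!: derivative_eq_intros simp: divide_simps)
    have ds: "((\<lambda>x. x / sqrt (1 - x\<^sup>2)) has_real_derivative 1 / (q * q * q)) (at x)"
    proof -
      have "((\<lambda>x. x / sqrt (1 - x\<^sup>2)) has_real_derivative (1 * q - x * (- x / q)) / (q * q)) (at x)"
        unfolding q_def by (rule DERIV_divide[OF DERIV_ident dq[unfolded q_def] nz(1)[unfolded q_def]])
      also have "(1 * q - x * (- x / q)) / (q * q) = (q * q + x\<^sup>2) / (q * q * q)"
        using nz by (simp add: field_simps power2_eq_square)
      finally show ?thesis by (simp add: q(2))
    qed
    have "((\<lambda>x. C (x / sqrt (1 - x\<^sup>2))) has_real_derivative A s * (1 / (q * q * q))) (at x)"
      unfolding s_def q_def by (rule DERIV_chain2[OF C ds[unfolded q_def]])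
    from DERIV_mult[OF this dq]
    have D: "((\<lambda>x. C (x / sqrt (1 - x\<^sup>2)) * sqrt (1 - x\<^sup>2)) has_real_derivative
        A s * (1 / (q * q * q)) * q + - x / q * C s) (at x)" by (simp add: q_def s_def)
    define E where "E = A s * (1 / (q * q * q)) * q + - x / q * C s"
    \<comment> \<open>As \<open>s / (1 + s^2) = x * q\<close>, solving for A shows that the left
      side of \<open>W\<close> is the left side of the reduced equation at x.\<close>
    have "q * q * E = A s - x * q * C s"
      using nz by (simp add: E_def field_simps)
    moreover have "A s = K3 + K2 * x - K * x\<^sup>2 - x * q * C s - (C s)\<^sup>2 / 2 * (q * q)"
    proof -
      have "s * q = x" using nz by (simp add: s_def)
      then have "(s * C s + (C s)\<^sup>2 / 2) / (1 / (q * q)) = x * q * C s + (C s)\<^sup>2 / 2 * (q * q)"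
        by (auto simp: algebra_simps)
      then show ?thesis using W[of s] unfolding M1 sr by linarith
    qed
    ultimately have "q * q * E + 2 * x * (C s * q) + (1/2) * (C s * q)\<^sup>2 = K3 + K2 * x - K * x\<^sup>2"
      by (simp add: power2_eq_square)
    moreover have "Pc ((K3 - K - K2) / 2, (K3 - K + K2) / 2, K) x = K3 + K2 * x - K * x\<^sup>2"
      by (simp add: Pc_def field_simps)
    ultimately have "(1 - x\<^sup>2) * E + 2 * x * (C s * q) + (1/2) * (C s * q)\<^sup>2
        = Pc ((K3 - K - K2) / 2, (K3 - K + K2) / 2, K) x"
      by (simp only: q(2))
    with D[folded E_def] show "\<exists>D. ((\<lambda>x. C (x / sqrt (1 - x\<^sup>2)) * sqrt (1 - x\<^sup>2)) has_real_derivative D) (at x) \<and>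
        (1 - x\<^sup>2) * D + 2 * x * (C (x / sqrt (1 - x\<^sup>2)) * sqrt (1 - x\<^sup>2))
        + (1/2) * (C (x / sqrt (1 - x\<^sup>2)) * sqrt (1 - x\<^sup>2))\<^sup>2
        = Pc ((K3 - K - K2) / 2, (K3 - K + K2) / 2, K) x"
      unfolding s_def q_def by blast
  qed
  then show ?thesis by blast
qed


section \<open>Partial derivatives of homogeneous and axisymmetric functions on the
  half-plane\<close>

lemma vector_3_add_axis:
  fixes a b c t :: real
  shows "(vector [a, b, c] :: real^3) + t *\<^sub>R axis 1 1 = vector [t + a, b, c]"
    "(vector [a, b, c] :: real^3) + t *\<^sub>R axis 2 1 = vector [a, t + b, c]"
    "(vector [a, b, c] :: real^3) + t *\<^sub>R axis 3 1 = vector [a, b, t + c]"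
  by (simp_all add: vec_eq_iff forall_3 vector_3 axis_def)

lemma pd_has_derivative:
  assumes "f differentiable (at x)"
  shows "((\<lambda>t. f (x + t *\<^sub>R axis i 1)) has_real_derivative pd i f x) (at 0)"
proof -
  have "(f \<circ> (\<lambda>t. x + t *\<^sub>R axis i 1)) differentiable (at (0::real))"
    by (rule differentiable_chain_at) (use assms in \<open>auto intro!: derivative_intros\<close>)
  then show ?thesis
    unfolding pd_def by (simp add: DERIV_deriv_iff_real_differentiable comp_def)
qed

lemma DERIV_pd:
  fixes f :: "real^3 \<Rightarrow> real" and a b c :: real
  assumes "f differentiable (at (vector [a, b, c]))"
  shows "((\<lambda>t. f (vector [t, b, c])) has_real_derivative pd 1 f (vector [a, b, c])) (at a)"
    "((\<lambda>t. f (vector [a, t, c])) has_real_derivative pd 2 f (vector [a, b, c])) (at b)"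
    "((\<lambda>t. f (vector [a, b, t])) has_real_derivative pd 3 f (vector [a, b, c])) (at c)"
  using pd_has_derivative[OF assms, of 1] pd_has_derivative[OF assms, of 2] pd_has_derivative[OF assms, of 3]
    DERIV_shift[of "\<lambda>t. f (vector [t, b, c])" _ 0 a] DERIV_shift[of "\<lambda>t. f (vector [a, t, c])" _ 0 b]
    DERIV_shift[of "\<lambda>t. f (vector [a, b, t])" _ 0 c]
  by (simp_all add: vector_3_add_axis)

lemma pd_eqI:
  fixes f :: "real^3 \<Rightarrow> real" and a b c :: real
  shows "((\<lambda>t. f (vector [t, b, c])) has_real_derivative D) (at a) \<Longrightarrow> pd 1 f (vector [a, b, c]) = D"
    "((\<lambda>t. f (vector [a, t, c])) has_real_derivative D) (at b) \<Longrightarrow> pd 2 f (vector [a, b, c]) = D"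
    "((\<lambda>t. f (vector [a, b, t])) has_real_derivative D) (at c) \<Longrightarrow> pd 3 f (vector [a, b, c]) = D"
  using DERIV_shift[of "\<lambda>t. f (vector [t, b, c])" D 0 a] DERIV_shift[of "\<lambda>t. f (vector [a, t, c])" D 0 b]
    DERIV_shift[of "\<lambda>t. f (vector [a, b, t])" D 0 c]
  by (simp_all add: pd_def vector_3_add_axis DERIV_imp_deriv)

lemma smooth3_differentiable: "smooth3 S f \<Longrightarrow> x \<in> S \<Longrightarrow> f differentiable (at x)"
  unfolding smooth3_def by (metis iter_pd.simps(1))

lemma iter_pd_append: "iter_pd (is @ js) f = iter_pd is (iter_pd js f)"
  by (induction "is") auto

lemma smooth3_pd:
  assumes "smooth3 S f"
  shows "smooth3 S (pd i f)"
  unfolding smooth3_def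
proof (intro allI ballI)
  fix "is" x assume "x \<in> S"
  then have "iter_pd (is @ [i]) f differentiable (at x)" using assms unfolding smooth3_def by blast
  then show "iter_pd is (pd i f) differentiable (at x)" by (simp add: iter_pd_append)
qed

lemma vector_in_Omega: "vector [a, b, c] \<in> Omega \<longleftrightarrow> a \<noteq> 0 \<or> b \<noteq> 0"
  by (simp add: Omega_def vector_3)

text \<open>Caratheodory's criterion with f itself as the slope function, so that continuity of f at
  0 is enough. Second derivatives across the half-plane are thereby computed from first derivatives
  of the profiles.\<close>

lemma DERIV_ident_mult:
  fixes f :: "real \<Rightarrow> real"
  assumes "isCont f 0"
  shows "((\<lambda>y. y * f y) has_real_derivative f 0) (at 0)"
  using assms by (auto simp: CARAT_DERIV intro!: exI[of _ f])

text \<open>Euler's relation for degree -n, written in the similarity variable c / t.\<close>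

lemma pd1_homogeneous:
  fixes f :: "real^3 \<Rightarrow> real" and g g1 :: "real \<Rightarrow> real"
  assumes f: "\<And>t c. t > 0 \<Longrightarrow> f (vector [t, 0, c]) = g (c / t) / t ^ n"
    and g: "\<And>s. (g has_real_derivative g1 s) (at s)" and t: "t > 0"
  shows "pd 1 f (vector [t, 0, c]) = - (real n * g (c / t) + c / t * g1 (c / t)) / t ^ Suc n"
proof (rule pd_eqI(1))
  have "((\<lambda>t. c / t) has_real_derivative - c / t\<^sup>2) (at t)"
    using t by (auto intro!: derivative_eq_intros simp: power2_eq_square)
  from DERIV_chain2[OF g this]
  have d: "((\<lambda>t. g (c / t)) has_real_derivative g1 (c / t) * (- c / t\<^sup>2)) (at t)" .
  have "((\<lambda>t. g (c / t) / t ^ n) has_real_derivative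
      (g1 (c / t) * (- c / t\<^sup>2) * t ^ n - g (c / t) * (real n * t ^ (n - Suc 0))) / (t ^ n * t ^ n)) (at t)"
    by (rule DERIV_divide[OF d]) (use t in \<open>auto intro!: derivative_eq_intros\<close>)
  also have "(g1 (c / t) * (- c / t\<^sup>2) * t ^ n - g (c / t) * (real n * t ^ (n - Suc 0))) / (t ^ n * t ^ n)
      = - (real n * g (c / t) + c / t * g1 (c / t)) / t ^ Suc n"
    using t by (cases n) (auto simp: field_simps power2_eq_square)
  finally show "((\<lambda>t. f (vector [t, 0, c])) has_real_derivative
      - (real n * g (c / t) + c / t * g1 (c / t)) / t ^ Suc n) (at t)"
    by (rule has_field_derivative_transform_within_open[where S = "{0<..}"]) (use t f in auto)
qed

text \<open>\<open>pd 1 f\<close> again has the homogeneous form, now with exponent 2, so the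
  previous lemma applies twice.\<close>

lemma pd11_homogeneous:
  fixes f :: "real^3 \<Rightarrow> real" and g g1 g2 :: "real \<Rightarrow> real"
  assumes f: "\<And>t c. t > 0 \<Longrightarrow> f (vector [t, 0, c]) = g (c / t) / t"
    and g: "\<And>s. (g has_real_derivative g1 s) (at s)" "\<And>s. (g1 has_real_derivative g2 s) (at s)"
  shows "pd 1 f (vector [1, 0, s]) = - (g s + s * g1 s)"
    "pd 1 (pd 1 f) (vector [1, 0, s]) = 2 * g s + 4 * s * g1 s + s\<^sup>2 * g2 s"
proof -
  have 1: "pd 1 f (vector [t, 0, c]) = - (g (c / t) + c / t * g1 (c / t)) / t ^ 2" if "t > 0" for t c
    using pd1_homogeneous[of f g 1 g1 t c] f g that by (simp add: numeral_2_eq_2)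
  then show "pd 1 f (vector [1, 0, s]) = - (g s + s * g1 s)" by simp
  have "((\<lambda>s. - (g s + s * g1 s)) has_real_derivative - (2 * g1 s + s * g2 s)) (at s)" for s
    by (auto intro!: derivative_eq_intros g)
  from pd1_homogeneous[OF 1 this, of 1 s]
  show "pd 1 (pd 1 f) (vector [1, 0, s]) = 2 * g s + 4 * s * g1 s + s\<^sup>2 * g2 s"
    by (simp add: algebra_simps power2_eq_square)
qed

text \<open>The derivative of \<open>g (s / \<rho>) / \<rho> ^ n\<close> with \<open>\<rho> = sqrt (1 + y\<^sup>2)\<close> is \<open>y\<close> times a continuous
  function, whose value at \<open>0\<close> is the second derivative there.\<close>

lemma pd22_axisymmetric:
  fixes f :: "real^3 \<Rightarrow> real" and g g1 :: "real \<Rightarrow> real"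
  assumes f: "\<And>y. f (vector [1, y, s]) = g (s / sqrt (1 + y\<^sup>2)) / sqrt (1 + y\<^sup>2) ^ n"
    and g: "\<And>s. (g has_real_derivative g1 s) (at s)" and g1: "isCont g1 s"
  shows "pd 2 (pd 2 f) (vector [1, 0, s]) = - (real n * g s + s * g1 s)"
proof -
  define \<rho> where "\<rho> y = sqrt (1 + y\<^sup>2)" for y :: real
  have \<rho>: "\<rho> y > 0" for y by (simp add: \<rho>_def add_pos_nonneg)
  define \<phi> where "\<phi> y = - (real n * g (s / \<rho> y) + s / \<rho> y * g1 (s / \<rho> y)) / \<rho> y ^ (n + 2)" for y
  have d: "pd 2 f (vector [1, y, s]) = y * \<phi> y" for y
  proof (rule pd_eqI(2))
    have "1 + y\<^sup>2 > 0" by (simp add: add_pos_nonneg)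
    then have d\<rho>: "(\<rho> has_real_derivative y / \<rho> y) (at y)"
      unfolding \<rho>_def by (auto intro!: derivative_eq_intros simp: divide_simps)
    have nz: "\<rho> y \<noteq> 0" using \<rho>[of y] by simp
    have "((\<lambda>y. s / \<rho> y) has_real_derivative (0 * \<rho> y - s * (y / \<rho> y)) / (\<rho> y * \<rho> y)) (at y)"
      by (rule DERIV_divide[OF DERIV_const d\<rho> nz])
    from DERIV_chain2[OF g this]
    have 1: "((\<lambda>y. g (s / \<rho> y)) has_real_derivative
      g1 (s / \<rho> y) * ((0 * \<rho> y - s * (y / \<rho> y)) / (\<rho> y * \<rho> y))) (at y)" .
    have 2: "((\<lambda>y. \<rho> y ^ n) has_real_derivative real n * \<rho> y ^ (n - Suc 0) * (y / \<rho> y)) (at y)"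
      using DERIV_power[OF d\<rho>, of n] by (simp add: mult_ac)
    have "((\<lambda>y. g (s / \<rho> y) / \<rho> y ^ n) has_real_derivative
      (g1 (s / \<rho> y) * ((0 * \<rho> y - s * (y / \<rho> y)) / (\<rho> y * \<rho> y)) * \<rho> y ^ n
        - g (s / \<rho> y) * (real n * \<rho> y ^ (n - Suc 0) * (y / \<rho> y))) / (\<rho> y ^ n * \<rho> y ^ n)) (at y)"
      by (rule DERIV_divide[OF 1 2]) (use nz in simp)
    also have "(g1 (s / \<rho> y) * ((0 * \<rho> y - s * (y / \<rho> y)) / (\<rho> y * \<rho> y)) * \<rho> y ^ n
        - g (s / \<rho> y) * (real n * \<rho> y ^ (n - Suc 0) * (y / \<rho> y))) / (\<rho> y ^ n * \<rho> y ^ n) = y * \<phi> y"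
    proof -
      show ?thesis unfolding \<phi>_def using nz by (cases n) (simp_all add: field_simps power2_eq_square)
    qed
    finally show "((\<lambda>t. f (vector [1, t, s])) has_real_derivative y * \<phi> y) (at y)"
      by (simp add: f \<rho>_def)
  qed
  have \<rho>0: "\<rho> 0 = 1" by (simp add: \<rho>_def)
  have "isCont \<rho> 0" unfolding \<rho>_def by (intro continuous_intros)
  then have q: "isCont (\<lambda>y. s / \<rho> y) 0" using \<rho>0 by (intro continuous_intros) auto
  have "isCont (\<lambda>y. g (s / \<rho> y)) 0" "isCont (\<lambda>y. g1 (s / \<rho> y)) 0"
    by (rule isCont_o2[OF q], use DERIV_isCont[OF g] g1 \<rho>0 in simp)+
  then have "isCont \<phi> 0"
    unfolding \<phi>_def using q \<open>isCont \<rho> 0\<close> \<rho>0 by (intro continuous_intros) auto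
  then have "((\<lambda>y. y * \<phi> y) has_real_derivative \<phi> 0) (at 0)"
    by (rule DERIV_ident_mult)
  then have "pd 2 (pd 2 f) (vector [1, 0, s]) = \<phi> 0"
    by (intro pd_eqI(2)) (simp add: d)
  then show ?thesis by (simp add: \<phi>_def \<rho>0)
qed

lemma spherical_frame_expansion:
  fixes v :: "real^3"
  shows "v $ 1 = (v \<bullet> e_r \<theta> \<phi>) * (sin \<theta> * cos \<phi>) + (v \<bullet> e_th \<theta> \<phi>) * (cos \<theta> * cos \<phi>) - (v \<bullet> e_ph \<theta> \<phi>) * sin \<phi>"
    "v $ 2 = (v \<bullet> e_r \<theta> \<phi>) * (sin \<theta> * sin \<phi>) + (v \<bullet> e_th \<theta> \<phi>) * (cos \<theta> * sin \<phi>) + (v \<bullet> e_ph \<theta> \<phi>) * cos \<phi>"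
    "v $ 3 = (v \<bullet> e_r \<theta> \<phi>) * cos \<theta> - (v \<bullet> e_th \<theta> \<phi>) * sin \<theta>"
proof -
  have r: "v \<bullet> e_r \<theta> \<phi> = v $ 1 * (sin \<theta> * cos \<phi>) + v $ 2 * (sin \<theta> * sin \<phi>) + v $ 3 * cos \<theta>"
    and th: "v \<bullet> e_th \<theta> \<phi> = v $ 1 * (cos \<theta> * cos \<phi>) + v $ 2 * (cos \<theta> * sin \<phi>) - v $ 3 * sin \<theta>"
    and ph: "v \<bullet> e_ph \<theta> \<phi> = - v $ 1 * sin \<phi> + v $ 2 * cos \<phi>"
    by (simp_all add: inner_vec_def sum_3 e_r_def e_th_def e_ph_def vector_3)
  note sc = sin_cos_squared_add[of \<theta>] sin_cos_squared_add[of \<phi>]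
  show "v $ 1 = (v \<bullet> e_r \<theta> \<phi>) * (sin \<theta> * cos \<phi>) + (v \<bullet> e_th \<theta> \<phi>) * (cos \<theta> * cos \<phi>) - (v \<bullet> e_ph \<theta> \<phi>) * sin \<phi>"
    unfolding r th ph using sc by algebra
  show "v $ 2 = (v \<bullet> e_r \<theta> \<phi>) * (sin \<theta> * sin \<phi>) + (v \<bullet> e_th \<theta> \<phi>) * (cos \<theta> * sin \<phi>) + (v \<bullet> e_ph \<theta> \<phi>) * cos \<phi>"
    unfolding r th ph using sc by algebra
  show "v $ 3 = (v \<bullet> e_r \<theta> \<phi>) * cos \<theta> - (v \<bullet> e_th \<theta> \<phi>) * sin \<theta>"
    unfolding r th ph using sc by algebra
qed

text \<open>The components in the spherical frame do not change with the azimuth and the azimuthal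
  one is zero, so u turns with the frame. On the half-plane of azimuth 0 the first Cartesian
  component is the one pointing away from the axis.\<close>

lemma axisymmetric_no_swirl_rotation:
  assumes ax: "axisymmetric u" and ns: "no_swirl u" and "\<rho> > 0"
  shows "u (vector [\<rho> * cos \<phi>, \<rho> * sin \<phi>, c]) $ 1 = cos \<phi> * u (vector [\<rho>, 0, c]) $ 1"
    "u (vector [\<rho> * cos \<phi>, \<rho> * sin \<phi>, c]) $ 2 = sin \<phi> * u (vector [\<rho>, 0, c]) $ 1"
    "u (vector [\<rho> * cos \<phi>, \<rho> * sin \<phi>, c]) $ 3 = u (vector [\<rho>, 0, c]) $ 3"
proof -
  define r where "r = sqrt (\<rho>\<^sup>2 + c\<^sup>2)"
  have r: "r > 0" "r\<^sup>2 = \<rho>\<^sup>2 + c\<^sup>2" using \<open>\<rho> > 0\<close> by (auto simp: r_def add_pos_nonneg)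
  define \<theta> where "\<theta> = arccos (c / r)"
  have "c\<^sup>2 < r\<^sup>2" using r \<open>\<rho> > 0\<close> by simp
  then have "\<bar>c\<bar> < r" using r(1) by (simp add: power2_less_imp_less abs_le_square_iff[symmetric] flip: not_le)
  then have c: "-1 < c / r" "c / r < 1" using r(1) by (auto simp: field_simps)
  have \<theta>: "\<theta> \<in> {0<..<pi}" unfolding \<theta>_def using arccos_lt_bounded[OF c] by simp
  have cth: "r * cos \<theta> = c" using c r(1) by (simp add: \<theta>_def)
  have sth: "r * sin \<theta> = \<rho>"
  proof (rule power2_eq_imp_eq)
    have "(r * sin \<theta>)\<^sup>2 + (r * cos \<theta>)\<^sup>2 = r\<^sup>2"
      by (simp add: power_mult_distrib distrib_left[symmetric])
    then show "(r * sin \<theta>)\<^sup>2 = \<rho>\<^sup>2" using r(2) cth by simp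
    show "0 \<le> r * sin \<theta>" using r(1) \<theta> sin_gt_zero[of \<theta>] by simp
  qed (use \<open>\<rho> > 0\<close> in simp)
  have sph: "sph r \<theta> \<psi> = vector [\<rho> * cos \<psi>, \<rho> * sin \<psi>, c]" for \<psi>
    by (simp add: sph_def cth sth mult.assoc[symmetric])
  have sph0: "sph r \<theta> 0 = vector [\<rho>, 0, c]" using sph[of 0] by simp
  have eq: "u (sph r \<theta> \<phi>) \<bullet> e_r \<theta> \<phi> = u (sph r \<theta> 0) \<bullet> e_r \<theta> 0"
    "u (sph r \<theta> \<phi>) \<bullet> e_th \<theta> \<phi> = u (sph r \<theta> 0) \<bullet> e_th \<theta> 0"
    using ax r(1) \<theta> unfolding axisymmetric_def u_r_def u_th_def by blast+
  have ph: "u (sph r \<theta> \<psi>) \<bullet> e_ph \<theta> \<psi> = 0" for \<psi>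
    using ns r(1) \<theta> unfolding no_swirl_def u_ph_def by blast
  note ex = spherical_frame_expansion[of "u (sph r \<theta> \<phi>)" \<theta> \<phi>, unfolded eq ph, unfolded sph sph0]
    and ex0 = spherical_frame_expansion[of "u (sph r \<theta> 0)" \<theta> 0, unfolded ph, unfolded sph0]
  show "u (vector [\<rho> * cos \<phi>, \<rho> * sin \<phi>, c]) $ 1 = cos \<phi> * u (vector [\<rho>, 0, c]) $ 1"
    unfolding ex(1) ex0(1) by (simp add: algebra_simps)
  show "u (vector [\<rho> * cos \<phi>, \<rho> * sin \<phi>, c]) $ 2 = sin \<phi> * u (vector [\<rho>, 0, c]) $ 1"
    unfolding ex(2) ex0(1) by (simp add: algebra_simps)
  show "u (vector [\<rho> * cos \<phi>, \<rho> * sin \<phi>, c]) $ 3 = u (vector [\<rho>, 0, c]) $ 3"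
    unfolding ex(3) ex0(3) by simp
qed

lemma homog_pair_half_plane:
  assumes "homog_pair u p" "\<rho> > 0"
  shows "u (vector [\<rho>, 0, c]) $ i = u (vector [1, 0, c / \<rho>]) $ i / \<rho>"
    "p (vector [\<rho>, 0, c]) = p (vector [1, 0, c / \<rho>]) / \<rho>\<^sup>2"
proof -
  have v: "\<rho> *\<^sub>R vector [1, 0, c / \<rho>] = (vector [\<rho>, 0, c] :: real^3)"
    using assms(2) by (simp add: vec_eq_iff forall_3 vector_3)
  have "vector [1, 0, c / \<rho>] \<in> Omega" by (simp add: vector_in_Omega)
  then have "u (vector [\<rho>, 0, c]) = (1 / \<rho>) *\<^sub>R u (vector [1, 0, c / \<rho>]) \<and>
      p (vector [\<rho>, 0, c]) = p (vector [1, 0, c / \<rho>]) / \<rho>\<^sup>2"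
    using assms v unfolding homog_pair_def by metis
  then show "u (vector [\<rho>, 0, c]) $ i = u (vector [1, 0, c / \<rho>]) $ i / \<rho>"
    "p (vector [\<rho>, 0, c]) = p (vector [1, 0, c / \<rho>]) / \<rho>\<^sup>2" by auto
qed

lemma NS_solution_imp_ode_sol:
  assumes hom: "homog_pair u p" and ax: "axisymmetric u" and ns: "no_swirl u"
    and su: "smooth3v Omega u" and sp: "smooth3 Omega p" and NS: "NS_solution_on Omega u p"
  obtains c U where "ode_sol c U" "\<And>\<theta>. \<theta> \<in> {0<..<pi} \<Longrightarrow> u_th u 1 \<theta> 0 * sin \<theta> = U (cos \<theta>)"
proof -
  define u1 where "u1 = (\<lambda>y. u y $ 1)"
  define u2 where "u2 = (\<lambda>y. u y $ 2)"
  define u3 where "u3 = (\<lambda>y. u y $ 3)"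
  have sm: "smooth3 Omega u1" "smooth3 Omega u2" "smooth3 Omega u3"
    using su by (auto simp: smooth3v_def u1_def u2_def u3_def)
  define A where "A s = u1 (vector [1, 0, s])" for s
  define A1 where "A1 s = pd 3 u1 (vector [1, 0, s])" for s
  define A2 where "A2 s = pd 3 (pd 3 u1) (vector [1, 0, s])" for s
  define B where "B s = u3 (vector [1, 0, s])" for s
  define B1 where "B1 s = pd 3 u3 (vector [1, 0, s])" for s
  define B2 where "B2 s = pd 3 (pd 3 u3) (vector [1, 0, s])" for s
  define P where "P s = p (vector [1, 0, s])" for s
  define P1 where "P1 s = pd 3 p (vector [1, 0, s])" for s
  have \<Omega>: "vector [1, b, s] \<in> Omega" for b s by (simp add: vector_in_Omega)
  have dA: "(A has_real_derivative A1 s) (at s)" "(A1 has_real_derivative A2 s) (at s)" for s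
    unfolding A_def A1_def A2_def
    by (rule DERIV_pd(3) smooth3_differentiable[OF _ \<Omega>] smooth3_pd sm)+
  have dB: "(B has_real_derivative B1 s) (at s)" "(B1 has_real_derivative B2 s) (at s)" for s
    unfolding B_def B1_def B2_def
    by (rule DERIV_pd(3) smooth3_differentiable[OF _ \<Omega>] smooth3_pd sm)+
  have dP: "(P has_real_derivative P1 s) (at s)" for s
    unfolding P_def P1_def by (rule DERIV_pd(3) smooth3_differentiable[OF _ \<Omega>] sp)+
  have half: "u1 (vector [t, 0, c]) = A (c / t) / t" "u3 (vector [t, 0, c]) = B (c / t) / t"
    "p (vector [t, 0, c]) = P (c / t) / t ^ 2" if "t > 0" for t c
    using homog_pair_half_plane[OF hom that] by (simp_all add: u1_def u3_def A_def B_def P_def)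
  \<comment> \<open>The point (1, y, s) has azimuth arctan y and distance sqrt (1 + y^2) from the
    axis. Homogeneity gives one power of that distance; for u1 and u2 the rotation contributes
    another one, through cos and sin of the azimuth.\<close>
  have rot: "u1 (vector [1, y, s]) = A (s / sqrt (1 + y\<^sup>2)) / sqrt (1 + y\<^sup>2) ^ 2"
    "u2 (vector [1, y, s]) = y * (A (s / sqrt (1 + y\<^sup>2)) / sqrt (1 + y\<^sup>2) ^ 2)"
    "u3 (vector [1, y, s]) = B (s / sqrt (1 + y\<^sup>2)) / sqrt (1 + y\<^sup>2) ^ 1" for y s
  proof -
    define \<rho> where "\<rho> = sqrt (1 + y\<^sup>2)"
    have \<rho>: "\<rho> > 0" by (simp add: \<rho>_def add_pos_nonneg)
    have cs: "\<rho> * cos (arctan y) = 1" "\<rho> * sin (arctan y) = y"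
      using \<rho> by (simp_all add: \<rho>_def cos_arctan sin_arctan)
    then have cs': "cos (arctan y) = 1 / \<rho>" "sin (arctan y) = y / \<rho>" using \<rho> by (simp_all add: field_simps)
    note R = axisymmetric_no_swirl_rotation[OF ax ns \<rho>, of "arctan y" s, unfolded cs, unfolded cs']
    show "u1 (vector [1, y, s]) = A (s / sqrt (1 + y\<^sup>2)) / sqrt (1 + y\<^sup>2) ^ 2"
      "u2 (vector [1, y, s]) = y * (A (s / sqrt (1 + y\<^sup>2)) / sqrt (1 + y\<^sup>2) ^ 2)"
      "u3 (vector [1, y, s]) = B (s / sqrt (1 + y\<^sup>2)) / sqrt (1 + y\<^sup>2) ^ 1"
      unfolding \<rho>_def[symmetric] using R half[OF \<rho>, of s]
      by (simp_all add: u1_def u2_def u3_def power2_eq_square)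
  qed
  have u20: "u2 (vector [1, 0, s]) = 0" for s using rot(2)[of 0 s] by simp
  have pd1: "pd 1 u1 (vector [1, 0, s]) = - (A s + s * A1 s)"
    "pd 1 (pd 1 u1) (vector [1, 0, s]) = 2 * A s + 4 * s * A1 s + s\<^sup>2 * A2 s"
    "pd 1 u3 (vector [1, 0, s]) = - (B s + s * B1 s)"
    "pd 1 (pd 1 u3) (vector [1, 0, s]) = 2 * B s + 4 * s * B1 s + s\<^sup>2 * B2 s"
    "pd 1 p (vector [1, 0, s]) = - (2 * P s + s * P1 s)" for s
    using pd11_homogeneous[OF half(1) dA, of s] pd11_homogeneous[OF half(2) dB, of s]
      pd1_homogeneous[OF half(3) dP, of 1 s] by simp_all
  have pd2: "pd 2 u2 (vector [1, 0, s]) = A s"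
    "pd 2 (pd 2 u1) (vector [1, 0, s]) = - (2 * A s + s * A1 s)"
    "pd 2 (pd 2 u3) (vector [1, 0, s]) = - (B s + s * B1 s)" for s
  proof -
    let ?\<phi> = "\<lambda>y. A (s / sqrt (1 + y\<^sup>2)) / sqrt (1 + y\<^sup>2) ^ 2"
    have q: "isCont (\<lambda>y::real. s / sqrt (1 + y\<^sup>2)) 0" by (intro continuous_intros) auto
    have "isCont (\<lambda>y::real. A (s / sqrt (1 + y\<^sup>2))) 0"
      by (rule isCont_o2[OF q]) (use DERIV_isCont[OF dA(1)] in simp)
    then have "isCont ?\<phi> 0" by (intro continuous_intros) auto
    then have "((\<lambda>y. y * ?\<phi> y) has_real_derivative ?\<phi> 0) (at 0)"
      by (rule DERIV_ident_mult)
    then show "pd 2 u2 (vector [1, 0, s]) = A s" by (intro pd_eqI(2)) (simp add: rot(2))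
    show "pd 2 (pd 2 u1) (vector [1, 0, s]) = - (2 * A s + s * A1 s)"
      using pd22_axisymmetric[OF rot(1) dA(1) DERIV_isCont[OF dA(2)]] by simp
    show "pd 2 (pd 2 u3) (vector [1, 0, s]) = - (B s + s * B1 s)"
      using pd22_axisymmetric[OF rot(3) dB(1) DERIV_isCont[OF dB(2)]] by simp
  qed
  have NSj: "- lap (\<lambda>y. u y $ j) (vector [1, 0, s]) + (\<Sum>i\<in>UNIV. u (vector [1, 0, s]) $ i * pd i (\<lambda>y. u y $ j) (vector [1, 0, s]))
      + pd j p (vector [1, 0, s]) = 0"
    and div: "(\<Sum>i\<in>UNIV. pd i (\<lambda>y. u y $ i) (vector [1, 0, s])) = 0" for j s
    using NS \<Omega> unfolding NS_solution_on_def by blast+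
  have divB: "B1 s = s * A1 s" for s
    using div[of s] unfolding sum_3 u1_def[symmetric] u2_def[symmetric] u3_def[symmetric] pd1 pd2
    by (simp add: B1_def[symmetric])
  have e1: "- (2 * A s + 4 * s * A1 s + s\<^sup>2 * A2 s + - (2 * A s + s * A1 s) + A2 s)
      + (A s * - (A s + s * A1 s) + B s * A1 s) + - (2 * P s + s * P1 s) = 0" for s
    using NSj[of 1 s] u20[of s]
    unfolding lap_def sum_3 u1_def[symmetric] pd1 pd2 A2_def[symmetric] A1_def[symmetric]
    by (simp add: A_def B_def u1_def u2_def u3_def)
  have e3: "- (2 * B s + 4 * s * B1 s + s\<^sup>2 * B2 s + - (B s + s * B1 s) + B2 s)
      + (A s * - (B s + s * B1 s) + B s * B1 s) + P1 s = 0" for s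
    using NSj[of 3 s] u20[of s]
    unfolding lap_def sum_3 u3_def[symmetric] pd1 pd2 B2_def[symmetric] B1_def[symmetric] P1_def[symmetric]
    by (simp add: A_def B_def u1_def u2_def u3_def)
  have B2: "B2 s = A1 s + s * A2 s" for s
  proof (rule DERIV_unique[OF dB(2)])
    have "B1 = (\<lambda>s. s * A1 s)" using divB by blast
    then show "(B1 has_real_derivative A1 s + s * A2 s) (at s)"
      by (auto intro!: derivative_eq_intros dA simp: algebra_simps)
  qed
  \<comment> \<open>A stream function: vanishing divergence, in the form
    \<open>B1 s = s * A1 s\<close>, makes A its derivative, so C determines both A and B. Moreover
    \<open>C (cot \<theta>) * sin \<theta>\<close> is u_\<theta> sin \<theta> at r = 1.\<close>
  define C where "C s = s * A s - B s" for s
  have dC: "(C has_real_derivative A s) (at s)" for s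
    unfolding C_def by (auto intro!: derivative_eq_intros dA dB simp: divB)
  have Bs: "B s = s * A s - C s" for s by (simp add: C_def)
  have "\<exists>c. ode_sol c (\<lambda>x. C (x / sqrt (1 - x\<^sup>2)) * sqrt (1 - x\<^sup>2))"
  proof (rule stream_function_imp_ode_sol[OF dC dA dP])
    show "- (1 + s\<^sup>2) * A2 s - 3 * s * A1 s - (A s)\<^sup>2 - C s * A1 s - 2 * P s - s * P1 s = 0" for s
      using e1[of s] unfolding Bs by algebra
    show "- (1 + s\<^sup>2) * (A1 s + s * A2 s) - 3 * s\<^sup>2 * A1 s - s * A s + C s - s * (A s)\<^sup>2 + C s * A s
      - s * C s * A1 s + P1 s = 0" for s
      using e3[of s] unfolding B2 divB Bs by algebra
  qed
  moreover have "u_th u 1 \<theta> 0 * sin \<theta> = C (cos \<theta> / sqrt (1 - (cos \<theta>)\<^sup>2)) * sqrt (1 - (cos \<theta>)\<^sup>2)"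
    if "\<theta> \<in> {0<..<pi}" for \<theta>
  proof -
    have s: "sin \<theta> > 0" using that sin_gt_zero by auto
    have sq: "sqrt (1 - (cos \<theta>)\<^sup>2) = sin \<theta>" using s by (simp add: sin_squared_eq[symmetric])
    have "u_th u 1 \<theta> 0 = u1 (vector [sin \<theta>, 0, cos \<theta>]) * cos \<theta> - u3 (vector [sin \<theta>, 0, cos \<theta>]) * sin \<theta>"
      by (simp add: u_th_def sph_def e_th_def u1_def u3_def inner_vec_def sum_3 vector_3)
    also have "\<dots> * sin \<theta> = A (cos \<theta> / sin \<theta>) * cos \<theta> - B (cos \<theta> / sin \<theta>) * sin \<theta>"
      using s unfolding half[OF s] by (simp add: field_simps)
    finally have E: "u_th u 1 \<theta> 0 * sin \<theta> = A (cos \<theta> / sin \<theta>) * cos \<theta> - B (cos \<theta> / sin \<theta>) * sin \<theta>" .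
    show ?thesis unfolding E sq C_def using s by (simp add: left_diff_distrib)
  qed
  ultimately show ?thesis using that by blast
qed

theorem theorem1p2:
  shows "(\<forall>c \<gamma>. (c, \<gamma>) \<in> Iset \<longrightarrow>
            (\<exists>U. C_inf_on {-1<..<1} U \<and> continuous_on {-1..1} U \<and> ode_sol c U \<and> U 0 = \<gamma> \<and>
               (\<forall>V. C_inf_on {-1<..<1} V \<and> continuous_on {-1..1} V \<and> ode_sol c V \<and> V 0 = \<gamma>
                    \<longrightarrow> (\<forall>x\<in>{-1..1}. V x = U x))))
       \<and> (\<forall>(u :: real^3 \<Rightarrow> real^3) (p :: real^3 \<Rightarrow> real).
            homog_pair u p \<and> axisymmetric u \<and> no_swirl u \<and> smooth3v Omega u \<and> smooth3 Omega p
            \<and> NS_solution_on Omega u p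
            \<longrightarrow> (\<exists>c \<gamma> U. (c, \<gamma>) \<in> Iset \<and> C_inf_on {-1<..<1} U \<and> continuous_on {-1..1} U
                   \<and> ode_sol c U \<and> U 0 = \<gamma>
                   \<and> (\<forall>\<theta>\<in>{0<..<pi}. u_th u 1 \<theta> 0 * sin \<theta> = U (cos \<theta>))))"
proof (intro conjI allI impI)
  fix c \<gamma> assume "(c, \<gamma>) \<in> Iset"
  then show "\<exists>U. C_inf_on {-1<..<1} U \<and> continuous_on {-1..1} U \<and> ode_sol c U \<and> U 0 = \<gamma> \<and>
      (\<forall>V. C_inf_on {-1<..<1} V \<and> continuous_on {-1..1} V \<and> ode_sol c V \<and> V 0 = \<gamma>
        \<longrightarrow> (\<forall>x\<in>{-1..1}. V x = U x))"
    by (rule Iset_existence_uniqueness)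
next
  fix u :: "real^3 \<Rightarrow> real^3" and p :: "real^3 \<Rightarrow> real"
  assume "homog_pair u p \<and> axisymmetric u \<and> no_swirl u \<and> smooth3v Omega u \<and> smooth3 Omega p
    \<and> NS_solution_on Omega u p"
  then obtain c U where U: "ode_sol c U" "\<And>\<theta>. \<theta> \<in> {0<..<pi} \<Longrightarrow> u_th u 1 \<theta> 0 * sin \<theta> = U (cos \<theta>)"
    using NS_solution_imp_ode_sol by metis
  obtain W where W: "ode_sol c W" "continuous_on {-1..1} W" "\<And>x. -1 < x \<Longrightarrow> x < 1 \<Longrightarrow> W x = U x"
    using ode_sol_extend[OF U(1)] by blast
  \<comment> \<open>Away from the poles cos \<theta> is interior, where W still agrees with
    U.\<close>
  have "u_th u 1 \<theta> 0 * sin \<theta> = W (cos \<theta>)" if "\<theta> \<in> {0<..<pi}" for \<theta>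
  proof -
    have "-1 < cos \<theta>" "cos \<theta> < 1"
      using that cos_monotone_0_pi[of \<theta> pi] cos_monotone_0_pi[of 0 \<theta>] by auto
    then show ?thesis using U(2)[OF that] W(3) by simp
  qed
  then show "\<exists>c \<gamma> U. (c, \<gamma>) \<in> Iset \<and> C_inf_on {-1<..<1} U \<and> continuous_on {-1..1} U
      \<and> ode_sol c U \<and> U 0 = \<gamma> \<and> (\<forall>\<theta>\<in>{0<..<pi}. u_th u 1 \<theta> 0 * sin \<theta> = U (cos \<theta>))"
    using ode_sol_imp_Iset[OF W(1)] ode_sol_C_inf[OF W(1)] W(1,2) by blast
qed

end
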